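(* Let $p\in(0,1)$ be a fixed constant and $\sigma^2=p(1-p)$. For an even integer $n$, let $M$ be the $n\times n$ matrix with $m_{ij}=p$ if $1\le |i-j|\le n/2-1$ and $m_{ij}=0$ otherwise, and let $\widehat{M}$ be a random symmetric $n\times n$ matrix with zero diagonal whose entries $\widehat m_{ij}$, $i<j$, are independent Bernoulli random variables with $\mathbb{P}(\widehat m_{ij}=1)=m_{ij}$. Let $x$ be a unit eigenvector of $M$ for $\lambda_2(M)$ and $\widehat{x}$ a unit eigenvector of $\widehat{M}$ for $\lambda_2(\widehat{M})$, with signs chosen so that $\langle x,\widehat x\rangle\ge 0$. Then there is a constant $C_0>0$ (independent of $n$) such that \[ \|x-\widehat{x}\|\le C_0 n^{-1/2} \] with probability at least $1-n^{-3}$.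
   Context: For a real symmetric matrix $X$, its eigenvalues are labelled $\lambda_1(X),\dots,\lambda_n(X)$ so that $|\lambda_1(X)|\ge|\lambda_2(X)|\ge\dots\ge|\lambda_n(X)|$; $\lambda_2(X)$ is the eigenvalue of second largest absolute value. $\|\cdot\|$ is the Euclidean norm. The matrix $M$ is the edge-probability ("model") matrix of the random linear graph and $\widehat M$ is the adjacency matrix of the random graph. *)

theory Defs
  imports "HOL-Probability.Product_PMF" "Jordan_Normal_Form.Char_Poly"
begin

definition vnorm :: "real vec \<Rightarrow> real" where
  "vnorm v = sqrt (scalar_prod v v)"

text \<open>mu is a possible value of lambda_2(X): the eigenvalues of X, listed with
  multiplicity (as the roots of the characteristic polynomial) in an order of
  non-increasing absolute value, have mu as second entry.\<close>
definition is_lambda2 :: "real mat \<Rightarrow> real \<Rightarrow> bool" where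
  "is_lambda2 X mu \<longleftrightarrow> (\<exists>es. char_poly X = (\<Prod>a\<leftarrow>es. [:- a, 1:])
      \<and> sorted_wrt (\<lambda>a b. \<bar>a\<bar> \<ge> \<bar>b\<bar>) es \<and> length es \<ge> 2 \<and> es ! 1 = mu)"

definition model_mat :: "real \<Rightarrow> nat \<Rightarrow> real mat" where
  "model_mat p n = mat n n (\<lambda>(i, j).
      if 1 \<le> nat \<bar>int i - int j\<bar> \<and> nat \<bar>int i - int j\<bar> \<le> n div 2 - 1 then p else 0)"

definition upper_pairs :: "nat \<Rightarrow> (nat \<times> nat) set" where
  "upper_pairs n = {(i, j). i < j \<and> j < n}"

definition edge_pmf :: "real \<Rightarrow> nat \<Rightarrow> (nat \<times> nat \<Rightarrow> bool) pmf" where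
  "edge_pmf p n = Pi_pmf (upper_pairs n) False
      (\<lambda>(i, j). bernoulli_pmf (model_mat p n $$ (i, j)))"

definition adj_mat :: "nat \<Rightarrow> (nat \<times> nat \<Rightarrow> bool) \<Rightarrow> real mat" where
  "adj_mat n \<omega> = mat n n (\<lambda>(i, j).
      if i < j then of_bool (\<omega> (i, j)) else if j < i then of_bool (\<omega> (j, i)) else 0)"

end

theory Submission
  imports Defs "Jordan_Normal_Form.Schur_Decomposition" "HOL-Probability.Hoeffding"
begin

text \<open>Write \<open>n = 2 m\<close>, \<open>M\<close> for the model matrix and \<open>E\<close> for the noise. By rounding vectors to integer points
  and Hoeffding's inequality, the operator norm of \<open>E\<close> is at most \<open>14 sqrt n\<close> outside an event of
  exponentially small probability.

  The eigenvalues of \<open>M\<close> are separated without being computed. In units of \<open>(p m)\<^sup>2\<close> the squared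
  Frobenius norm is at most \<open>3\<close>; the constant vector shows \<open>\<lambda>\<^sub>1\<^sup>2 \<ge> 2.3\<close>; the plane spanned by the
  constant vector and the linear vector \<open>j \<mapsto> 2 j + 1 - n\<close>, whose images under \<open>M\<close> are orthogonal by
  parity, shows \<open>\<lambda>\<^sub>2\<^sup>2 \<ge> 0.39\<close>. Hence \<open>\<lambda>\<^sub>2\<^sup>2 \<le> 0.7\<close> and \<open>\<lambda>\<^sub>k\<^sup>2 \<le> 0.31\<close> for \<open>k \<ge> 3\<close>, so \<open>\<bar>\<lambda>\<^sub>2\<bar>\<close> has
  distance of order \<open>n\<close> from all other \<open>\<bar>\<lambda>\<^sub>k\<bar>\<close>.

  Weyl's inequality for absolute values keeps \<open>\<bar>\<lambda>\<^sub>2\<bar>\<close> of the random matrix near that of \<open>M\<close>, and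
  expanding its eigenvector in an eigenbasis of \<open>M\<close> (Davis--Kahan) bounds the distance of the two
  eigenvectors by a multiple of \<open>\<parallel>E\<parallel> / n\<close>, which is of order \<open>1 / sqrt n\<close>.\<close>

section \<open>Spectral theorem for real symmetric matrices\<close>

lemma scalar_prod_self_nonneg: "scalar_prod (v :: real vec) v \<ge> 0"
  by (simp add: scalar_prod_def sum_nonneg)

lemma scalar_prod_self_eq_0_iff:
  "v \<in> carrier_vec n \<Longrightarrow> scalar_prod (v :: real vec) v = 0 \<longleftrightarrow> v = 0\<^sub>v n"
  using conjugate_square_eq_0_vec[of v n] by simp

text \<open>Gram-Schmidt applied to a basis completion of \<open>v\<close> leaves the first vector
  unchanged; scaling the columns to length one then makes the matrix orthogonal, with a multiple of
  \<open>v\<close> in front.\<close>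

lemma exists_orthogonal_mat_with_first_col:
  fixes v :: "real vec"
  assumes v: "v \<in> carrier_vec n" and v0: "v \<noteq> 0\<^sub>v n" and n: "n \<noteq> 0"
  obtains U r where "U \<in> carrier_mat n n" "transpose_mat U * U = 1\<^sub>m n" "col U 0 = r \<cdot>\<^sub>v v"
proof -
  interpret cof_vec_space n "TYPE(real)" .
  define b where "b = basis_completion v"
  define ws where "ws = gram_schmidt n b"
  from basis_completion[OF v v0, folded b_def]
  have dist_b: "distinct b"
    and indep: "\<not> lin_dep (set b)" and b: "set b \<subseteq> carrier_vec n" and hdb: "hd b = v"
    and len_b: "length b = n" by auto
  from hdb len_b n obtain vs where bv: "b = v # vs" by (cases b, auto)
  from gram_schmidt_result[OF b dist_b indep refl, folded ws_def]
  have ws: "set ws \<subseteq> carrier_vec n" "corthogonal ws" "length ws = n"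
    by (auto simp: len_b)
  from gram_schmidt_hd[OF v, of vs, folded bv] have hdws: "hd ws = v" unfolding ws_def .
  have wsc: "ws ! i \<in> carrier_vec n" if "i < n" for i
    using ws that by (auto simp: set_conv_nth)
  have orth: "scalar_prod (ws ! i) (ws ! j) = 0 \<longleftrightarrow> i \<noteq> j" if "i < n" "j < n" for i j
    using corthogonalD[OF ws(2), of i j] that ws(3) by simp
  define a where "a i = 1 / vnorm (ws ! i)" for i
  define U where "U = mat_of_cols n (map (\<lambda>i. a i \<cdot>\<^sub>v ws ! i) [0..<n])"
  have U: "U \<in> carrier_mat n n" by (simp add: U_def mat_of_cols_def)
  have colU: "col U i = a i \<cdot>\<^sub>v ws ! i" if "i < n" for i
    unfolding U_def using that wsc by (subst col_mat_of_cols) auto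
  have "transpose_mat U * U = 1\<^sub>m n"
  proof (rule eq_matI, goal_cases)
    case (1 i j)
    then have ij: "i < n" "j < n" by auto
    have "(transpose_mat U * U) $$ (i, j) = scalar_prod (col U i) (col U j)"
      using U ij by simp
    also have "\<dots> = a i * a j * scalar_prod (ws ! i) (ws ! j)"
      using ij wsc[OF ij(1)] wsc[OF ij(2)] by (simp add: colU)
    also have "\<dots> = 1\<^sub>m n $$ (i, j)"
    proof (cases "i = j")
      case True
      have "scalar_prod (ws ! i) (ws ! i) > 0"
        using orth[OF ij(1) ij(1)] scalar_prod_self_nonneg[of "ws ! i"] by linarith
      then show ?thesis using True ij by (simp add: a_def vnorm_def)
    qed (use orth[OF ij] ij in auto)
    finally show ?case .
  qed (use U in auto)
  moreover have "col U 0 = a 0 \<cdot>\<^sub>v v"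
    using colU[of 0] n hdws ws(3) by (metis gr0I hd_conv_nth length_0_conv)
  ultimately show ?thesis using that U by blast
qed

lemma diagonal_mat_Cons:
  "four_block_mat (mat 1 1 (\<lambda>_. e)) (0\<^sub>m 1 n) (0\<^sub>m n 1)
      (mat n n (\<lambda>(i, j). if i = j then es ! i else 0)) =
    mat (Suc n) (Suc n) (\<lambda>(i, j). if i = j then (e # es) ! i else 0)"
  by (rule eq_matI) (auto simp: nth_Cons split: nat.splits)

text \<open>Deflation along the list of roots: an orthogonal matrix whose first column is an
  eigenvector for \<open>e\<close> splits off \<open>e\<close>, and the remaining symmetric block
  has the remaining roots. The diagonal follows the order of the given list, so a list sorted by
  modulus yields an eigenbasis sorted in the same way.\<close>

theorem real_spectral_theorem:
  fixes A :: "real mat"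
  assumes "A \<in> carrier_mat n n" "transpose_mat A = A"
    and "char_poly A = (\<Prod>e\<leftarrow>es. [:- e, 1:])"
  shows "length es = n \<and> (\<exists>Q \<in> carrier_mat n n. transpose_mat Q * Q = 1\<^sub>m n \<and>
    transpose_mat Q * A * Q = mat n n (\<lambda>(i, j). if i = j then es ! i else 0))"
  using assms
proof (induction es arbitrary: n A)
  case Nil
  with degree_monic_char_poly[of A n] have "n = 0" by simp
  with Nil show ?case by (auto intro!: bexI[of _ "1\<^sub>m 0"])
next
  case (Cons e es n A)
  note A = Cons.prems(1)
  have cp: "char_poly A = [: -e, 1 :] * (\<Prod>e \<leftarrow> es. [:- e, 1:])" using Cons.prems by simp
  have mon: "monic (\<Prod>e\<leftarrow> es. [:- e, 1:])" by (rule monic_prod_list, auto)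
  have "degree (char_poly A) = Suc (degree (\<Prod>e\<leftarrow> es. [:- e, 1:]))"
    unfolding cp by (subst degree_mult_eq, insert mon, auto)
  with degree_monic_char_poly[OF A] obtain k where n: "n = Suc k" by (cases n) auto
  have "eigenvalue A e"
    unfolding eigenvalue_root_char_poly[OF A] cp by simp
  then obtain v where "eigenvector A v e" unfolding eigenvalue_def by auto
  then have v: "v \<in> carrier_vec n" "v \<noteq> 0\<^sub>v n" "A *\<^sub>v v = e \<cdot>\<^sub>v v"
    using A by (auto simp: eigenvector_def)
  obtain U r where U: "U \<in> carrier_mat n n" and UU: "transpose_mat U * U = 1\<^sub>m n"
    and colU: "col U 0 = r \<cdot>\<^sub>v v"
    using exists_orthogonal_mat_with_first_col[OF v(1,2)] n by auto
  have UU': "U * transpose_mat U = 1\<^sub>m n"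
    using mat_mult_left_right_inverse[OF _ U UU] U by simp
  define B where "B = transpose_mat U * A * U"
  have B: "B \<in> carrier_mat n n" unfolding B_def using A U by simp
  have symB: "transpose_mat B = B"
    unfolding B_def using A U Cons.prems(2) by (simp add: transpose_mult[of _ n n _ n])
  \<comment> \<open>The first column of \<open>U\<close> is an eigenvector for \<open>e\<close> and
    the columns are orthonormal, so the first column of \<open>B\<close> is \<open>e\<close> times
    the first unit vector. Symmetry gives the same for the first row.\<close>
  have B0: "B $$ (i, 0) = (if i = 0 then e else 0)" if i: "i < n" for i
  proof -
    have "A *\<^sub>v col U 0 = e \<cdot>\<^sub>v col U 0"
      using A v by (simp add: colU mult_mat_vec[of _ n n] smult_smult_assoc mult.commute)
    moreover have "col (A * U) 0 = A *\<^sub>v col U 0"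
      using A U n by (subst col_mult2[of _ n n _ n]) auto
    moreover have "B = transpose_mat U * (A * U)"
      unfolding B_def using A U by simp
    ultimately have "B $$ (i, 0) = scalar_prod (col U i) (e \<cdot>\<^sub>v col U 0)"
      using A U n i by (simp del: col_mult2)
    also have "\<dots> = e * (transpose_mat U * U) $$ (i, 0)"
      using U n i by (simp add: scalar_prod_smult_distrib[of _ n])
    finally show ?thesis using n i unfolding UU by simp
  qed
  have B0': "B $$ (0, i) = (if i = 0 then e else 0)" if i: "i < n" for i
    using B0[OF i] symB B n i by (metis carrier_matD index_transpose_mat(1) zero_less_Suc)
  define B3 where "B3 = mat k k (\<lambda>(i, j). B $$ (Suc i, Suc j))"
  have B3: "B3 \<in> carrier_mat k k" by (simp add: B3_def)
  have Bblock: "B = four_block_mat (mat 1 1 (\<lambda>_. e)) (0\<^sub>m 1 k) (0\<^sub>m k 1) B3"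
    by (rule eq_matI) (use B B0 B0' n in \<open>auto simp: B3_def\<close>)
  have symB3: "transpose_mat B3 = B3"
  proof (rule eq_matI)
    fix i j assume "i < dim_row B3" "j < dim_col B3"
    then have "i < k" "j < k" by (auto simp: B3_def)
    moreover have "B $$ (Suc j, Suc i) = B $$ (Suc i, Suc j)"
      using symB B n calculation by (metis Suc_less_eq carrier_matD index_transpose_mat(1))
    ultimately show "transpose_mat B3 $$ (i, j) = B3 $$ (i, j)" by (simp add: B3_def)
  qed (auto simp: B3_def)
  \<comment> \<open>Similar matrices share the characteristic polynomial; cancelling the factor of
    \<open>e\<close> leaves that of \<open>B3\<close>, as the induction hypothesis requires.\<close>
  have "similar_mat_wit B A (transpose_mat U) U"
    by (rule similar_mat_witI[of _ _ n]) (use U UU UU' A B in \<open>auto simp: B_def\<close>)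
  then have "char_poly A = char_poly B"
    using char_poly_similar unfolding similar_mat_def by metis
  also have "char_poly B = char_poly (mat 1 1 (\<lambda>_. e) :: real mat) * char_poly B3"
    unfolding Bblock by (rule char_poly_four_block_zeros_col[OF _ _ B3]) auto
  also have "char_poly (mat 1 1 (\<lambda>_. e) :: real mat) = [:-e, 1:]"
    by (simp add: char_poly_defs det_def sign_def)
  finally have "char_poly B3 = (\<Prod>e \<leftarrow> es. [:- e, 1:])"
    using cp by (metis mult_cancel_left pCons_eq_0_iff zero_neq_one)
  from Cons.IH[OF B3 symB3 this] obtain R where len: "length es = k"
    and R: "R \<in> carrier_mat k k" and RR: "transpose_mat R * R = 1\<^sub>m k"
    and RBR: "transpose_mat R * B3 * R = mat k k (\<lambda>(i, j). if i = j then es ! i else 0)"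
    by auto
  define P where "P = four_block_mat (1\<^sub>m 1) (0\<^sub>m 1 k) (0\<^sub>m k 1) R"
  have P: "P \<in> carrier_mat n n" unfolding P_def n using R by auto
  have PT: "transpose_mat P = four_block_mat (1\<^sub>m 1) (0\<^sub>m 1 k) (0\<^sub>m k 1) (transpose_mat R)"
    unfolding P_def using R by (subst transpose_four_block_mat) auto
  have PP: "transpose_mat P * P = 1\<^sub>m n"
    unfolding PT unfolding P_def n using R RR
    by (subst mult_four_block_mat[of _ 1 1 _ k _ k _ _ 1 _ k]) auto
  have PTB: "transpose_mat P * B =
      four_block_mat (mat 1 1 (\<lambda>_. e)) (0\<^sub>m 1 k) (0\<^sub>m k 1) (transpose_mat R * B3)"
    unfolding PT Bblock using R B3
    by (subst mult_four_block_mat[of _ 1 1 _ k _ k _ _ 1 _ k]) auto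
  have "transpose_mat P * B * P =
      four_block_mat (mat 1 1 (\<lambda>_. e)) (0\<^sub>m 1 k) (0\<^sub>m k 1) (transpose_mat R * B3 * R)"
    unfolding PTB unfolding P_def using R B3
    by (subst mult_four_block_mat[of _ 1 1 _ k _ k _ _ 1 _ k]) auto
  then have PBP: "transpose_mat P * B * P =
      mat n n (\<lambda>(i, j). if i = j then (e # es) ! i else 0)"
    unfolding RBR diagonal_mat_Cons n .
  have T: "transpose_mat (U * P) = transpose_mat P * transpose_mat U"
    using U P by (rule transpose_mult)
  have tc: "transpose_mat U \<in> carrier_mat n n" "transpose_mat P \<in> carrier_mat n n"
    using U P by auto
  have "transpose_mat (U * P) * (U * P) = transpose_mat P * (transpose_mat U * U) * P"
    unfolding T using U P tc
    by (smt (verit, ccfv_SIG) assoc_mult_mat mult_carrier_mat)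
  then have 1: "transpose_mat (U * P) * (U * P) = 1\<^sub>m n"
    using UU PP tc by simp
  have "transpose_mat (U * P) * A * (U * P) = transpose_mat P * B * P"
    unfolding T B_def using U P A tc
    by (smt (verit, ccfv_SIG) assoc_mult_mat mult_carrier_mat)
  with 1 PBP len n U P show ?case by (auto intro!: bexI[of _ "U * P"])
qed

section \<open>Perturbation of the second eigenvector\<close>

lemma vnorm_conv_L2_set: "vnorm v = L2_set (\<lambda>i. v $ i) {0..<dim_vec v}"
  by (simp add: vnorm_def L2_set_def scalar_prod_def power2_eq_square)

lemma vnorm_nonneg: "vnorm v \<ge> 0"
  by (simp add: vnorm_def scalar_prod_self_nonneg)

lemma vnorm_sq: "(vnorm v)\<^sup>2 = scalar_prod v v"
  by (simp add: vnorm_def scalar_prod_self_nonneg)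

lemma vnorm_triangle:
  assumes "v \<in> carrier_vec n" "w \<in> carrier_vec n"
  shows "vnorm (v + w) \<le> vnorm v + vnorm w"
  using L2_set_triangle_ineq[of "\<lambda>i. v $ i" "\<lambda>i. w $ i" "{0..<n}"] assms
  by (auto simp: vnorm_conv_L2_set L2_set_def)

lemma vnorm_minus_commute:
  assumes "v \<in> carrier_vec n" "w \<in> carrier_vec n"
  shows "vnorm (v - w) = vnorm (w - v)"
  using assms by (simp add: vnorm_def scalar_prod_def algebra_simps)

text \<open>Turn \<open>(s, t)\<close> by a right angle and normalise. This is the dimension count
  behind both min-max arguments: a plane contains a nonzero vector orthogonal to a given
  one.\<close>

lemma exists_orthogonal_coefficients:
  fixes s t :: real
  obtains a b where "a\<^sup>2 + b\<^sup>2 = 1" "a * s + b * t = 0"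
proof (cases "s = 0 \<and> t = 0")
  case True
  then show ?thesis using that[of 1 0] by simp
next
  case False
  then have pos: "s\<^sup>2 + t\<^sup>2 > 0" by (simp add: sum_power2_gt_zero_iff)
  let ?r = "sqrt (s\<^sup>2 + t\<^sup>2)"
  have "(t / ?r)\<^sup>2 + (- s / ?r)\<^sup>2 = 1"
    using pos False by (simp add: power_divide add_divide_distrib[symmetric] add.commute[of "t\<^sup>2"])
  moreover have "t / ?r * s + - s / ?r * t = 0" by simp
  ultimately show ?thesis using that by blast
qed

lemma scalar_prod_lincomb_self:
  fixes v w :: "real vec"
  assumes "v \<in> carrier_vec n" "w \<in> carrier_vec n"
  shows "scalar_prod (a \<cdot>\<^sub>v v + b \<cdot>\<^sub>v w) (a \<cdot>\<^sub>v v + b \<cdot>\<^sub>v w) =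
    a\<^sup>2 * scalar_prod v v + 2 * a * b * scalar_prod v w + b\<^sup>2 * scalar_prod w w"
  using assms comm_scalar_prod[of v n w]
  by (simp add: add_scalar_prod_distrib[of _ n] scalar_prod_add_distrib[of _ n] power2_eq_square algebra_simps)

section \<open>Coordinates in an orthonormal eigenbasis\<close>

locale eigenbasis =
  fixes n :: nat and Q A :: "real mat" and es :: "real list"
  assumes Q: "Q \<in> carrier_mat n n" and A: "A \<in> carrier_mat n n"
    and QQ: "transpose_mat Q * Q = 1\<^sub>m n"
    and QAQ: "transpose_mat Q * A * Q = mat n n (\<lambda>(i, j). if i = j then es ! i else 0)"
begin

definition coord :: "real vec \<Rightarrow> nat \<Rightarrow> real" where
  "coord y k = scalar_prod (col Q k) y"

lemma col_carrier: "col Q k \<in> carrier_vec n"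
  using Q by auto

lemma QQ': "Q * transpose_mat Q = 1\<^sub>m n"
  using mat_mult_left_right_inverse[OF _ Q QQ] Q by simp

lemma coord_eq: "k < n \<Longrightarrow> coord y k = (transpose_mat Q *\<^sub>v y) $ k"
  using Q by (simp add: coord_def)

lemma coord_add: "\<lbrakk>y \<in> carrier_vec n; z \<in> carrier_vec n\<rbrakk> \<Longrightarrow> coord (y + z) k = coord y k + coord z k"
  unfolding coord_def using col_carrier by (rule scalar_prod_add_distrib)

lemma coord_diff: "\<lbrakk>y \<in> carrier_vec n; z \<in> carrier_vec n\<rbrakk> \<Longrightarrow> coord (y - z) k = coord y k - coord z k"
  unfolding coord_def using col_carrier by (rule scalar_prod_minus_distrib)

lemma coord_smult: "y \<in> carrier_vec n \<Longrightarrow> coord (a \<cdot>\<^sub>v y) k = a * coord y k"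
  unfolding coord_def using Q by simp

lemma coord_col: "\<lbrakk>k < n; l < n\<rbrakk> \<Longrightarrow> coord (col Q l) k = (if k = l then 1 else 0)"
proof -
  assume kl: "k < n" "l < n"
  then have "coord (col Q l) k = (transpose_mat Q * Q) $$ (k, l)"
    using Q by (simp add: coord_def)
  then show ?thesis using kl by (simp add: QQ)
qed

lemma parseval:
  assumes y: "y \<in> carrier_vec n" and z: "z \<in> carrier_vec n"
  shows "scalar_prod y z = (\<Sum>k<n. coord y k * coord z k)"
proof -
  have "scalar_prod y z = scalar_prod ((Q * transpose_mat Q) *\<^sub>v y) z"
    unfolding QQ' using y by simp
  also have "\<dots> = scalar_prod (Q *\<^sub>v (transpose_mat Q *\<^sub>v y)) z"
    using Q y by (simp add: assoc_mult_mat_vec[of _ n n _ n])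
  also have "\<dots> = scalar_prod (transpose_mat Q *\<^sub>v y) (transpose_mat Q *\<^sub>v z)"
    using Q y z transpose_vec_mult_scalar[of "transpose_mat Q" n n z "transpose_mat Q *\<^sub>v y"] by simp
  also have "\<dots> = (\<Sum>k<n. coord y k * coord z k)"
    using Q by (simp add: scalar_prod_def coord_eq atLeast0LessThan)
  finally show ?thesis .
qed

lemma norm_coord: "y \<in> carrier_vec n \<Longrightarrow> scalar_prod y y = (\<Sum>k<n. (coord y k)\<^sup>2)"
  by (simp add: parseval power2_eq_square)

lemma coord_mult:
  assumes y: "y \<in> carrier_vec n" and k: "k < n"
  shows "coord (A *\<^sub>v y) k = es ! k * coord y k"
proof -
  let ?T = "transpose_mat Q"
  have T: "?T \<in> carrier_mat n n" using Q by simp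
  have TA: "?T * A \<in> carrier_mat n n" using T A by simp
  have Ty: "?T *\<^sub>v y \<in> carrier_vec n" using T y by simp
  have "?T *\<^sub>v (A *\<^sub>v y) = ?T * A *\<^sub>v (1\<^sub>m n *\<^sub>v y)"
    using T A y by (simp add: assoc_mult_mat_vec[of _ n n _ n])
  also have "1\<^sub>m n *\<^sub>v y = Q *\<^sub>v (?T *\<^sub>v y)"
    unfolding QQ'[symmetric] using Q T y by (rule assoc_mult_mat_vec)
  also have "?T * A *\<^sub>v (Q *\<^sub>v (?T *\<^sub>v y)) = (?T * A * Q) *\<^sub>v (?T *\<^sub>v y)"
    using TA Q Ty by (rule assoc_mult_mat_vec[symmetric])
  finally have "coord (A *\<^sub>v y) k =
      (mat n n (\<lambda>(i, j). if i = j then es ! i else 0) *\<^sub>v (?T *\<^sub>v y)) $ k"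
    using k by (simp add: coord_eq QAQ)
  also have "\<dots> = (\<Sum>i<n. (if k = i then es ! k else 0) * (?T *\<^sub>v y) $ i)"
    using k Q by (simp add: scalar_prod_def atLeast0LessThan)
  also have "\<dots> = (\<Sum>i<n. if i = k then es ! k * (?T *\<^sub>v y) $ i else 0)"
    by (rule sum.cong) auto
  also have "\<dots> = es ! k * coord y k"
    using k by (subst sum.delta) (auto simp: coord_eq)
  finally show ?thesis .
qed

lemma mult_carrier: "A *\<^sub>v y \<in> carrier_vec n"
  using A by (intro carrier_vecI) simp

text \<open>The sum of the squared norms of the images \<open>A q\<close> over all columns
  \<open>q\<close> of \<open>Q\<close> is evaluated twice: each term is the square of an eigenvalue,
  and, taken row by row, Parseval turns the sum into squared norms of the rows of
  \<open>A\<close>.\<close>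

lemma frobenius: "(\<Sum>k<n. (es ! k)\<^sup>2) = (\<Sum>i<n. \<Sum>j<n. (A $$ (i, j))\<^sup>2)"
proof -
  have "(\<Sum>k<n. (es ! k)\<^sup>2) = (\<Sum>k<n. scalar_prod (A *\<^sub>v col Q k) (A *\<^sub>v col Q k))"
  proof (rule sum.cong[OF refl])
    fix k assume k: "k \<in> {..<n}"
    have "scalar_prod (A *\<^sub>v col Q k) (A *\<^sub>v col Q k) =
        (\<Sum>l<n. (es ! l * coord (col Q k) l)\<^sup>2)"
      using mult_carrier col_carrier by (simp add: norm_coord coord_mult)
    also have "\<dots> = (\<Sum>l<n. if l = k then (es ! k)\<^sup>2 else 0)"
      using k by (intro sum.cong) (auto simp: coord_col)
    finally show "(es ! k)\<^sup>2 = scalar_prod (A *\<^sub>v col Q k) (A *\<^sub>v col Q k)"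
      using k by simp
  qed
  also have "\<dots> = (\<Sum>k<n. \<Sum>i<n. (coord (row A i) k)\<^sup>2)"
  proof (rule sum.cong[OF refl])
    fix k assume "k \<in> {..<n}"
    have "(A *\<^sub>v col Q k) $ i = coord (row A i) k" if "i < n" for i
      using that A Q comm_scalar_prod[OF _ col_carrier, of "row A i" k] by (simp add: coord_def)
    then show "scalar_prod (A *\<^sub>v col Q k) (A *\<^sub>v col Q k) = (\<Sum>i<n. (coord (row A i) k)\<^sup>2)"
      using A by (simp add: scalar_prod_def[of "A *\<^sub>v col Q k"] atLeast0LessThan power2_eq_square)
  qed
  also have "\<dots> = (\<Sum>i<n. \<Sum>k<n. (coord (row A i) k)\<^sup>2)"
    by (rule sum.swap)
  also have "\<dots> = (\<Sum>i<n. scalar_prod (row A i) (row A i))"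
    using A by (intro sum.cong refl) (simp add: norm_coord)
  also have "\<dots> = (\<Sum>i<n. \<Sum>j<n. (A $$ (i, j))\<^sup>2)"
    using A by (intro sum.cong refl) (simp add: scalar_prod_def atLeast0LessThan power2_eq_square)
  finally show ?thesis .
qed

text \<open>Only the eigenvalues that occur in the expansion of \<open>y\<close> are bounded, so the
  lemma serves arbitrary vectors as well as those orthogonal to the first eigenvector.\<close>

lemma norm_mult_upper:
  assumes y: "y \<in> carrier_vec n" and s: "\<And>k. k < n \<Longrightarrow> coord y k \<noteq> 0 \<Longrightarrow> (es ! k)\<^sup>2 \<le> s"
  shows "scalar_prod (A *\<^sub>v y) (A *\<^sub>v y) \<le> s * scalar_prod y y"
proof -
  have "(\<Sum>k<n. (es ! k)\<^sup>2 * (coord y k)\<^sup>2) \<le> (\<Sum>k<n. s * (coord y k)\<^sup>2)"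
  proof (rule sum_mono)
    fix k assume "k \<in> {..<n}"
    then show "(es ! k)\<^sup>2 * (coord y k)\<^sup>2 \<le> s * (coord y k)\<^sup>2"
      using s[of k] by (cases "coord y k = 0") (auto intro: mult_right_mono)
  qed
  then show ?thesis
    using y mult_carrier by (simp add: norm_coord coord_mult power_mult_distrib sum_distrib_left)
qed

end

section \<open>Min-max bounds for the second eigenvalue\<close>

locale sorted_eigenbasis = eigenbasis +
  assumes sorted: "sorted_wrt (\<lambda>a b. \<bar>a\<bar> \<ge> \<bar>b\<bar>) es" and len: "length es = n" and n2: "n \<ge> 2"
begin

lemma abs_nth_mono: "\<lbrakk>i \<le> j; j < n\<rbrakk> \<Longrightarrow> \<bar>es ! j\<bar> \<le> \<bar>es ! i\<bar>"
  using sorted sorted_wrt_nth_less[OF sorted, of i j] len by (cases "i = j") auto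

lemma sq_nth_mono: "\<lbrakk>i \<le> j; j < n\<rbrakk> \<Longrightarrow> (es ! j)\<^sup>2 \<le> (es ! i)\<^sup>2"
  using abs_nth_mono by (simp add: abs_le_square_iff)

lemma norm_mult_first:
  "y \<in> carrier_vec n \<Longrightarrow> scalar_prod (A *\<^sub>v y) (A *\<^sub>v y) \<le> (es ! 0)\<^sup>2 * scalar_prod y y"
  by (rule norm_mult_upper) (auto intro: sq_nth_mono)

lemma norm_mult_second:
  assumes "y \<in> carrier_vec n" "coord y 0 = 0"
  shows "scalar_prod (A *\<^sub>v y) (A *\<^sub>v y) \<le> (es ! 1)\<^sup>2 * scalar_prod y y"
  by (rule norm_mult_upper) (use assms in \<open>auto intro!: sq_nth_mono simp: Suc_le_eq intro: gr0I\<close>)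

text \<open>Courant-Fischer for the square of \<open>A\<close>: the plane of \<open>v\<close> and
  \<open>w\<close> contains a nonzero vector orthogonal to the first eigenvector. The two
  orthogonality conditions remove the mixed terms, so the lower bound on the whole plane reduces to
  \<open>v\<close> and \<open>w\<close>.\<close>

lemma second_ge_of_plane:
  assumes v: "v \<in> carrier_vec n" "v \<noteq> 0\<^sub>v n" and w: "w \<in> carrier_vec n" "w \<noteq> 0\<^sub>v n"
    and vw: "scalar_prod v w = 0" "scalar_prod (A *\<^sub>v v) (A *\<^sub>v w) = 0"
    and s: "scalar_prod (A *\<^sub>v v) (A *\<^sub>v v) \<ge> s * scalar_prod v v"
      "scalar_prod (A *\<^sub>v w) (A *\<^sub>v w) \<ge> s * scalar_prod w w"
  shows "(es ! 1)\<^sup>2 \<ge> s"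
proof -
  obtain a b where ab: "a\<^sup>2 + b\<^sup>2 = 1" "a * coord v 0 + b * coord w 0 = 0"
    using exists_orthogonal_coefficients by blast
  let ?y = "a \<cdot>\<^sub>v v + b \<cdot>\<^sub>v w"
  have y: "?y \<in> carrier_vec n" using v w by simp
  have Ay: "A *\<^sub>v ?y = a \<cdot>\<^sub>v (A *\<^sub>v v) + b \<cdot>\<^sub>v (A *\<^sub>v w)"
    using A v w by (simp add: mult_add_distrib_mat_vec[of _ n n] mult_mat_vec[of _ n n])
  have pos: "scalar_prod v v > 0" "scalar_prod w w > 0"
    using v w scalar_prod_self_nonneg[of v] scalar_prod_self_nonneg[of w]
      scalar_prod_self_eq_0_iff[of v n] scalar_prod_self_eq_0_iff[of w n] by linarith+
  have yy: "scalar_prod ?y ?y = a\<^sup>2 * scalar_prod v v + b\<^sup>2 * scalar_prod w w"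
    using v w vw by (simp add: scalar_prod_lincomb_self)
  have "s * scalar_prod ?y ?y =
      a\<^sup>2 * (s * scalar_prod v v) + b\<^sup>2 * (s * scalar_prod w w)"
    unfolding yy by (simp add: algebra_simps)
  also have "\<dots> \<le> a\<^sup>2 * scalar_prod (A *\<^sub>v v) (A *\<^sub>v v) + b\<^sup>2 * scalar_prod (A *\<^sub>v w) (A *\<^sub>v w)"
    using s by (intro add_mono mult_left_mono) auto
  also have "\<dots> = scalar_prod (A *\<^sub>v ?y) (A *\<^sub>v ?y)"
    unfolding Ay using scalar_prod_lincomb_self[OF mult_carrier mult_carrier, of a v b w] vw by simp
  also have "\<dots> \<le> (es ! 1)\<^sup>2 * scalar_prod ?y ?y"
    using y ab v w by (intro norm_mult_second) (auto simp: coord_add coord_smult)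
  finally have le: "s * scalar_prod ?y ?y \<le> (es ! 1)\<^sup>2 * scalar_prod ?y ?y" .
  have "scalar_prod ?y ?y > 0"
    unfolding yy using pos ab(1)
    by (cases "a = 0") (auto intro!: add_pos_nonneg)
  then show ?thesis using le by simp
qed

text \<open>The other half of min-max: every hyperplane meets the span of the first two
  eigenvectors, where \<open>A\<close> stretches by at least the modulus of the second
  eigenvalue.\<close>

lemma exists_unit_orthogonal_second:
  assumes w: "w \<in> carrier_vec n"
  obtains y where "y \<in> carrier_vec n" "scalar_prod y y = 1" "scalar_prod w y = 0"
    "scalar_prod (A *\<^sub>v y) (A *\<^sub>v y) \<ge> (es ! 1)\<^sup>2"
proof -
  obtain a b where ab: "a\<^sup>2 + b\<^sup>2 = 1"
      "a * scalar_prod w (col Q 0) + b * scalar_prod w (col Q 1) = 0"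
    using exists_orthogonal_coefficients by blast
  let ?y = "a \<cdot>\<^sub>v col Q 0 + b \<cdot>\<^sub>v col Q 1"
  have y: "?y \<in> carrier_vec n" using col_carrier by simp
  have c: "coord ?y k = (if k = 0 then a else if k = 1 then b else 0)" if "k < n" for k
    using that n2 col_carrier by (simp add: coord_add coord_smult coord_col)
  have S: "(\<Sum>k<n. f k * (coord ?y k)\<^sup>2) = f 0 * a\<^sup>2 + f 1 * b\<^sup>2" for f :: "nat \<Rightarrow> real"
  proof -
    have "(\<Sum>k<n. f k * (coord ?y k)\<^sup>2) = (\<Sum>k\<in>{0, 1}. f k * (coord ?y k)\<^sup>2)"
      using n2 by (intro sum.mono_neutral_right) (auto simp: c simp del: One_nat_def)
    then show ?thesis using n2 c[of 0] c[of 1] by simp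
  qed
  have yy: "scalar_prod ?y ?y = 1"
    using S[of "\<lambda>_. 1"] ab y by (simp add: norm_coord)
  have "scalar_prod w ?y = 0"
    using ab w col_carrier by (simp add: scalar_prod_add_distrib[of _ n] scalar_prod_smult_distrib[of _ n])
  moreover have "scalar_prod (A *\<^sub>v ?y) (A *\<^sub>v ?y) = (es ! 0)\<^sup>2 * a\<^sup>2 + (es ! 1)\<^sup>2 * b\<^sup>2"
    using S[of "\<lambda>k. (es ! k)\<^sup>2"] y mult_carrier by (simp add: norm_coord coord_mult power_mult_distrib)
  moreover have "(es ! 1)\<^sup>2 * a\<^sup>2 \<le> (es ! 0)\<^sup>2 * a\<^sup>2"
    using n2 by (intro mult_right_mono sq_nth_mono) auto
  moreover have "(es ! 1)\<^sup>2 * a\<^sup>2 + (es ! 1)\<^sup>2 * b\<^sup>2 = (es ! 1)\<^sup>2"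
    using ab by (simp flip: distrib_left)
  ultimately show ?thesis using that[OF y yy] by linarith
qed

end

text \<open>Weyl's inequality for moduli: take a unit vector in the span of the top two eigenvectors
  of \<open>A\<close> that is orthogonal to the top eigenvector of \<open>B\<close>, and compare its
  images under both matrices.\<close>

lemma second_eigenvalue_perturbation:
  assumes "sorted_eigenbasis n Q A es" "sorted_eigenbasis n R B fs"
    and close: "\<And>y. y \<in> carrier_vec n \<Longrightarrow> vnorm (A *\<^sub>v y - B *\<^sub>v y) \<le> eta * vnorm y"
  shows "\<bar>es ! 1\<bar> \<le> \<bar>fs ! 1\<bar> + eta"
proof -
  interpret A: sorted_eigenbasis n Q A es by fact
  interpret B: sorted_eigenbasis n R B fs by fact
  obtain y where y: "y \<in> carrier_vec n" "scalar_prod y y = 1" "scalar_prod (col R 0) y = 0"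
    "scalar_prod (A *\<^sub>v y) (A *\<^sub>v y) \<ge> (es ! 1)\<^sup>2"
    using A.exists_unit_orthogonal_second[OF B.col_carrier[of 0]] by blast
  have "\<bar>es ! 1\<bar> \<le> vnorm (A *\<^sub>v y)"
    unfolding vnorm_def using y(4) by (simp add: real_le_rsqrt)
  also have "A *\<^sub>v y = B *\<^sub>v y + (A *\<^sub>v y - B *\<^sub>v y)"
    using A.A B.A by (intro eq_vecI) auto
  also have "vnorm \<dots> \<le> vnorm (B *\<^sub>v y) + vnorm (A *\<^sub>v y - B *\<^sub>v y)"
    using A.mult_carrier B.mult_carrier by (intro vnorm_triangle[of _ n]) auto
  also have "vnorm (B *\<^sub>v y) \<le> \<bar>fs ! 1\<bar>"
    unfolding vnorm_def using B.norm_mult_second[of y] y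
    by (intro real_le_lsqrt) (auto simp: B.coord_def)
  also have "vnorm (A *\<^sub>v y - B *\<^sub>v y) \<le> eta"
    using close[of y] y by (simp add: vnorm_def)
  finally show ?thesis by simp
qed

text \<open>Davis-Kahan in coordinates: the residual of the approximate eigenpair
  \<open>(t, z)\<close> has coordinates \<open>(es ! k - t) * coord z k\<close>, so the part of
  \<open>z\<close> off the second eigenvector has norm at most \<open>eta / g\<close>.\<close>

lemma (in sorted_eigenbasis) second_eigenvector_perturbation:
  assumes x: "x \<in> carrier_vec n" "scalar_prod x x = 1" "A *\<^sub>v x = es ! 1 \<cdot>\<^sub>v x"
    and z: "z \<in> carrier_vec n" "scalar_prod z z = 1"
    and xz: "scalar_prod x z \<ge> 0"
    and simple: "\<And>k. k < n \<Longrightarrow> k \<noteq> 1 \<Longrightarrow> es ! k \<noteq> es ! 1"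
    and g: "g > 0" "\<And>k. k < n \<Longrightarrow> k \<noteq> 1 \<Longrightarrow> \<bar>es ! k - t\<bar> \<ge> g"
    and eta: "vnorm (A *\<^sub>v z - t \<cdot>\<^sub>v z) \<le> eta"
  shows "vnorm (x - z) \<le> 2 * eta / g"
proof -
  have one: "1 < n" using n2 by simp
  \<comment> \<open>The second eigenvalue is simple, so \<open>x\<close> is plus or minus the second
    column of \<open>Q\<close>; the sign is settled by \<open>xz\<close>.\<close>
  have x0: "coord x k = 0" if k: "k < n" "k \<noteq> 1" for k
  proof -
    have "es ! k * coord x k = es ! 1 * coord x k"
      using coord_mult[OF x(1) k(1)] x(1,3) by (metis coord_smult)
    then show ?thesis using simple[OF k] mult_right_cancel by blast
  qed
  have S: "(\<Sum>k<n. f k) = f 1 + (\<Sum>k\<in>{..<n} - {1}. f k)" for f :: "nat \<Rightarrow> real"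
    using one by (subst sum.remove[of _ 1]) auto
  have "scalar_prod x x = (coord x 1)\<^sup>2"
    using x x0 by (simp add: norm_coord S)
  then have x1: "\<bar>coord x 1\<bar> = 1" using x(2) by (simp add: abs_square_eq_1)
  have "scalar_prod x z = coord x 1 * coord z 1"
    using x z x0 by (simp add: parseval S)
  then have xz': "scalar_prod x z = \<bar>coord z 1\<bar>"
    using xz x1 abs_mult[of "coord x 1" "coord z 1"] by simp
  define r where "r = (\<Sum>k\<in>{..<n} - {1}. (coord z k)\<^sup>2)"
  have z1: "(coord z 1)\<^sup>2 = 1 - r"
    using z by (simp add: norm_coord S r_def)
  have r0: "r \<ge> 0" unfolding r_def by (rule sum_nonneg) simp
  \<comment> \<open>A number of modulus at most one dominates its square, which bounds the inner
    product below by \<open>1 - r\<close> without a square root.\<close>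
  have "(coord z 1)\<^sup>2 \<le> \<bar>coord z 1\<bar>"
  proof -
    have "\<bar>coord z 1\<bar> \<le> 1" using z1 r0 abs_square_le_1[of "coord z 1"] by simp
    then have "\<bar>coord z 1\<bar> * \<bar>coord z 1\<bar> \<le> \<bar>coord z 1\<bar>" by (intro mult_left_le) auto
    then show ?thesis by (simp add: power2_eq_square)
  qed
  then have c: "1 - r \<le> scalar_prod x z" using xz' z1 by simp
  have Az: "A *\<^sub>v z \<in> carrier_vec n" "t \<cdot>\<^sub>v z \<in> carrier_vec n" using mult_carrier z by auto
  have "g\<^sup>2 * r = (\<Sum>k\<in>{..<n} - {1}. g\<^sup>2 * (coord z k)\<^sup>2)"
    by (simp add: r_def sum_distrib_left)
  also have "\<dots> \<le> (\<Sum>k\<in>{..<n} - {1}. ((es ! k - t) * coord z k)\<^sup>2)"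
  proof (rule sum_mono)
    fix k assume "k \<in> {..<n} - {1}"
    then have "\<bar>g\<bar> \<le> \<bar>es ! k - t\<bar>" using g by auto
    then have "g\<^sup>2 \<le> (es ! k - t)\<^sup>2" by (simp add: abs_le_square_iff)
    then show "g\<^sup>2 * (coord z k)\<^sup>2 \<le> ((es ! k - t) * coord z k)\<^sup>2"
      by (simp add: power_mult_distrib mult_right_mono)
  qed
  also have "\<dots> \<le> (\<Sum>k<n. ((es ! k - t) * coord z k)\<^sup>2)"
    by (rule sum_mono2) auto
  also have "\<dots> = (\<Sum>k<n. (coord (A *\<^sub>v z - t \<cdot>\<^sub>v z) k)\<^sup>2)"
    using z Az by (intro sum.cong) (auto simp: coord_diff coord_smult coord_mult algebra_simps)
  also have "\<dots> = (vnorm (A *\<^sub>v z - t \<cdot>\<^sub>v z))\<^sup>2"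
    using Az by (simp add: vnorm_sq norm_coord)
  also have "\<dots> \<le> eta\<^sup>2" using eta vnorm_nonneg by (intro power_mono)
  finally have gr: "g\<^sup>2 * r \<le> eta\<^sup>2" .
  have eta0: "eta \<ge> 0" using eta vnorm_nonneg order_trans by blast
  have "scalar_prod (x - z) (x - z) = 2 - 2 * scalar_prod x z"
    using x z comm_scalar_prod[of x n z]
    by (simp add: minus_scalar_prod_distrib[of _ n] scalar_prod_minus_distrib[of _ n])
  also have "\<dots> \<le> 2 * r" using c by simp
  \<comment> \<open>The loss of a factor 2 makes the final bound a perfect square.\<close>
  also have "\<dots> \<le> 4 * r" using r0 by simp
  also have "\<dots> \<le> (2 * eta / g)\<^sup>2"
    using gr g by (simp add: power_divide power_mult_distrib field_simps)
  finally show ?thesis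
    unfolding vnorm_def using eta0 g by (intro real_le_lsqrt) auto
qed

text \<open>Only absolute values are separated: an eigenvalue of a perturbed matrix whose modulus is close to
  that of \<open>es ! 1\<close> is then far from all other eigenvalues, whatever its sign.\<close>
definition abs_gap :: "real mat \<Rightarrow> real \<Rightarrow> bool" where
  "abs_gap A g \<longleftrightarrow> (\<forall>es. char_poly A = (\<Prod>a\<leftarrow>es. [:- a, 1:])
      \<and> sorted_wrt (\<lambda>a b. \<bar>a\<bar> \<ge> \<bar>b\<bar>) es \<longrightarrow>
      \<bar>es ! 1\<bar> + g \<le> \<bar>es ! 0\<bar> \<and> (\<forall>k. 2 \<le> k \<and> k < length es \<longrightarrow> \<bar>es ! k\<bar> + g \<le> \<bar>es ! 1\<bar>))"

lemma sorted_eigenbasis_exists: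
  assumes "A \<in> carrier_mat n n" "transpose_mat A = A" "n \<ge> 2"
    and "char_poly A = (\<Prod>e\<leftarrow>es. [:- e, 1:])" "sorted_wrt (\<lambda>a b. \<bar>a\<bar> \<ge> \<bar>b\<bar>) es"
  obtains Q where "sorted_eigenbasis n Q A es"
proof -
  from real_spectral_theorem[OF assms(1,2,4)] obtain Q where "length es = n" "Q \<in> carrier_mat n n"
    "transpose_mat Q * Q = 1\<^sub>m n"
    "transpose_mat Q * A * Q = mat n n (\<lambda>(i, j). if i = j then es ! i else 0)" by blast
  then have "sorted_eigenbasis n Q A es"
    using assms by unfold_locales auto
  then show ?thesis by (rule that)
qed

text \<open>\<open>z\<close> is an approximate eigenvector of \<open>A\<close> for
  \<open>mu\<close>, with residual \<open>A z - B z\<close>. Weyl's inequality moves the modulus of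
  \<open>mu\<close> by at most \<open>eta\<close>, which uses up at most half of the gap
  \<open>2 * g\<close>.\<close>

theorem lambda2_eigenvector_perturbation:
  assumes A: "A \<in> carrier_mat n n" "transpose_mat A = A" and B: "B \<in> carrier_mat n n" "transpose_mat B = B"
    and n2: "n \<ge> 2" and gap: "abs_gap A (2 * g)" "g > 0" and eta: "eta \<le> g"
    and close: "\<And>y. y \<in> carrier_vec n \<Longrightarrow> vnorm (A *\<^sub>v y - B *\<^sub>v y) \<le> eta * vnorm y"
    and x: "is_lambda2 A lam" "eigenvector A x lam" "vnorm x = 1"
    and z: "is_lambda2 B mu" "eigenvector B z mu" "vnorm z = 1"
    and xz: "scalar_prod x z \<ge> 0"
  shows "vnorm (x - z) \<le> 2 * eta / g"
proof -
  obtain es where es: "char_poly A = (\<Prod>a\<leftarrow>es. [:- a, 1:])"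
      "sorted_wrt (\<lambda>a b. \<bar>a\<bar> \<ge> \<bar>b\<bar>) es" "es ! 1 = lam"
    using x(1) unfolding is_lambda2_def by auto
  obtain fs where fs: "char_poly B = (\<Prod>a\<leftarrow>fs. [:- a, 1:])"
      "sorted_wrt (\<lambda>a b. \<bar>a\<bar> \<ge> \<bar>b\<bar>) fs" "fs ! 1 = mu"
    using z(1) unfolding is_lambda2_def by auto
  obtain Q where Q: "sorted_eigenbasis n Q A es"
    using sorted_eigenbasis_exists[OF A n2 es(1,2)] .
  obtain R where R: "sorted_eigenbasis n R B fs"
    using sorted_eigenbasis_exists[OF B n2 fs(1,2)] .
  interpret A: sorted_eigenbasis n Q A es by fact
  interpret B: sorted_eigenbasis n R B fs by fact
  have xv: "x \<in> carrier_vec n" "A *\<^sub>v x = lam \<cdot>\<^sub>v x" and zv: "z \<in> carrier_vec n" "B *\<^sub>v z = mu \<cdot>\<^sub>v z"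
    using x z A B by (auto simp: eigenvector_def)
  have "vnorm (B *\<^sub>v y - A *\<^sub>v y) \<le> eta * vnorm y" if "y \<in> carrier_vec n" for y
  proof -
    have "vnorm (B *\<^sub>v y - A *\<^sub>v y) = vnorm (A *\<^sub>v y - B *\<^sub>v y)"
      using A.mult_carrier B.mult_carrier by (rule vnorm_minus_commute[rotated])
    then show ?thesis using close[OF that] by simp
  qed
  then have weyl: "\<bar>lam\<bar> \<le> \<bar>mu\<bar> + eta" "\<bar>mu\<bar> \<le> \<bar>lam\<bar> + eta"
    using second_eigenvalue_perturbation[OF Q R close] second_eigenvalue_perturbation[OF R Q]
      es(3) fs(3) by auto
  have gap': "\<bar>lam\<bar> + 2 * g \<le> \<bar>es ! k\<bar> \<or> \<bar>es ! k\<bar> + 2 * g \<le> \<bar>lam\<bar>"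
    if "k < n" "k \<noteq> 1" for k
    using gap es A.len that unfolding abs_gap_def
    by (cases "k = 0") (auto simp: numeral_2_eq_2)
  \<comment> \<open>The difference of the moduli bounds the distance from below, whatever the
    signs.\<close>
  have g: "\<bar>es ! k - mu\<bar> \<ge> g" if "k < n" "k \<noteq> 1" for k
    using gap'[OF that] weyl eta by linarith
  have simple: "es ! k \<noteq> es ! 1" if "k < n" "k \<noteq> 1" for k
    using gap'[OF that] gap(2) es(3) by auto
  have "vnorm (A *\<^sub>v z - mu \<cdot>\<^sub>v z) \<le> eta"
    using close[OF zv(1)] z(3) zv(2) by simp
  then show ?thesis
    using A.second_eigenvector_perturbation[OF xv(1) _ _ zv(1) _ xz simple gap(2) g]
      x(3) z(3) xv es(3) by (simp add: vnorm_def)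
qed

section \<open>Operator norm of the noise\<close>

text \<open>Hoeffding's inequality: the variable with coefficient \<open>a k\<close> lies between
  \<open>0\<close> and \<open>a k\<close>, an interval of length
  \<open>\<bar>a k\<bar>\<close>.\<close>

lemma bernoulli_sum_tail:
  fixes a q :: "'a \<Rightarrow> real"
  assumes fin: "finite I" and q: "\<And>k. k \<in> I \<Longrightarrow> 0 \<le> q k \<and> q k \<le> 1"
    and V: "(\<Sum>k\<in>I. (a k)\<^sup>2) \<le> V" and s: "s > 0"
  shows "measure_pmf.prob (Pi_pmf I False (\<lambda>k. bernoulli_pmf (q k)))
    {\<omega>. (\<Sum>k\<in>I. a k * (of_bool (\<omega> k) - q k)) \<ge> s} \<le> exp (- 2 * s\<^sup>2 / V)"
proof (cases "(\<Sum>k\<in>I. (a k)\<^sup>2) > 0")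
  case False
  \<comment> \<open>Hoeffding's bound needs a positive sum of squared lengths; if all coefficients
    vanish, the event is empty because \<open>s > 0\<close>.\<close>
  then have "\<forall>k\<in>I. a k = 0"
    using fin sum_nonneg_eq_0_iff[of I "\<lambda>k. (a k)\<^sup>2"] sum_nonneg[of I "\<lambda>k. (a k)\<^sup>2"] by force
  then have "{\<omega>. (\<Sum>k\<in>I. a k * (of_bool (\<omega> k) - q k)) \<ge> s} = {}"
    using s by auto
  then show ?thesis by simp
next
  case True
  define P where "P = Pi_pmf I False (\<lambda>k. bernoulli_pmf (q k))"
  define X where "X k \<omega> = a k * of_bool (\<omega> k)" for k and \<omega> :: "'a \<Rightarrow> bool"
  have ind: "prob_space.indep_vars (measure_pmf P) (\<lambda>_. borel) X I"
    unfolding X_def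
    using prob_space.indep_vars_compose2[OF prob_space_measure_pmf indep_vars_Pi_pmf[OF fin],
        of "\<lambda>k b. a k * of_bool b" "\<lambda>_. borel" False "\<lambda>k. bernoulli_pmf (q k)"]
    by (simp add: P_def)
  have ex: "measure_pmf.expectation P (X k) = a k * q k" if k: "k \<in> I" for k
  proof -
    have "measure_pmf.expectation P (X k) =
        measure_pmf.expectation (map_pmf (\<lambda>\<omega>. \<omega> k) P) (\<lambda>b. a k * of_bool b)"
    proof -
      have "X k = (\<lambda>\<omega>. a k * of_bool (\<omega> k))" by (simp add: X_def fun_eq_iff)
      then show ?thesis by simp
    qed
    also have "map_pmf (\<lambda>\<omega>. \<omega> k) P = bernoulli_pmf (q k)"
      unfolding P_def by (subst Pi_pmf_component[OF fin]) (simp add: k)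
    finally show ?thesis using q[OF k] by simp
  qed
  interpret Hoeffding_ineq "measure_pmf P" I X "\<lambda>k. min 0 (a k)" "\<lambda>k. max 0 (a k)"
    "\<Sum>k\<in>I. measure_pmf.expectation P (X k)"
    by unfold_locales (auto simp: fin ind X_def AE_measure_pmf_iff)
  have w: "(\<Sum>k\<in>I. (max 0 (a k) - min 0 (a k))\<^sup>2) = (\<Sum>k\<in>I. (a k)\<^sup>2)"
    by (intro sum.cong) (auto simp: max_def min_def)
  have "measure_pmf.prob P {\<omega>. (\<Sum>k\<in>I. a k * (of_bool (\<omega> k) - q k)) \<ge> s} =
      measure_pmf.prob P {\<omega> \<in> space P. (\<Sum>k\<in>I. X k \<omega>) \<ge> (\<Sum>k\<in>I. measure_pmf.expectation P (X k)) + s}"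
    by (simp add: ex X_def sum_subtractf algebra_simps)
  also have "\<dots> \<le> exp (- 2 * s\<^sup>2 / (\<Sum>k\<in>I. (a k)\<^sup>2))"
    using Hoeffding_ineq_ge[of s] True s unfolding w by simp
  also have "\<dots> \<le> exp (- 2 * s\<^sup>2 / V)"
    using True V by (simp add: frac_le)
  finally show ?thesis unfolding P_def .
qed

section \<open>Integer points as a net for the bilinear form\<close>

lemma sum_half_powers_abs: "(\<Sum>k = - int L..int L. c / 2 ^ nat \<bar>k\<bar>) = 3 * c - 2 * c / (2 :: real) ^ L"
proof (induction L)
  case (Suc L)
  have eq: "{- int (Suc L)..int (Suc L)} = insert (int (Suc L)) (insert (- int (Suc L)) {- int L..int L})"
    by auto
  have "nat \<bar>int (Suc L)\<bar> = Suc L" "nat \<bar>- int (Suc L)\<bar> = Suc L" by linarith+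
  moreover have "int (Suc L) \<notin> insert (- int (Suc L)) {- int L..int L}" "- int (Suc L) \<notin> {- int L..int L}"
    by auto
  ultimately have "(\<Sum>k = - int (Suc L)..int (Suc L). c / 2 ^ nat \<bar>k\<bar>) =
      2 * (c / 2 ^ Suc L) + (\<Sum>k = - int L..int L. c / 2 ^ nat \<bar>k\<bar>)"
    unfolding eq by (subst sum.insert, simp, blast, subst sum.insert) auto
  then show ?case using Suc.IH by (simp add: field_simps)
qed simp

text \<open>The radius \<open>2 * sqrt n\<close> is what rounding a vector of norm at most
  \<open>sqrt n\<close> can produce. Extensional functions keep the set finite.\<close>

definition lattice_ball :: "nat \<Rightarrow> (nat \<Rightarrow> int) set" where
  "lattice_ball n = {z \<in> {..<n} \<rightarrow>\<^sub>E UNIV. (\<Sum>i<n. (z i)\<^sup>2) \<le> 4 * int n}"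

text \<open>The number of lattice points is bounded by the sum of the weights \<open>\<Prod>i<n. 16 / 2 ^ \<bar>z i\<bar>\<close>, each of
  which is at least \<open>1\<close> on the ball since \<open>\<bar>k\<bar> \<le> k\<^sup>2\<close> for integers.\<close>
lemma lattice_ball_finite_card: "finite (lattice_ball n) \<and> real (card (lattice_ball n)) \<le> 48 ^ n"
proof -
  define B where "B = ({..<n} \<rightarrow>\<^sub>E {- int (4 * n)..int (4 * n)})"
  have finB: "finite B" unfolding B_def by (intro finite_PiE) auto
  have abs_le: "\<bar>k\<bar> \<le> k\<^sup>2" for k :: int
  proof (cases "k = 0")
    case False
    then have "\<bar>k\<bar> * 1 \<le> \<bar>k\<bar> * \<bar>k\<bar>" by (intro mult_left_mono) auto
    then show ?thesis by (simp add: power2_eq_square)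
  qed simp
  have sub: "lattice_ball n \<subseteq> B"
  proof
    fix z assume z: "z \<in> lattice_ball n"
    have bd: "\<bar>z i\<bar> \<le> 4 * int n" if "i < n" for i
    proof -
      have "(z i)\<^sup>2 \<le> (\<Sum>i<n. (z i)\<^sup>2)"
        using that by (intro member_le_sum) auto
      then show ?thesis using z abs_le[of "z i"] unfolding lattice_ball_def by simp
    qed
    show "z \<in> B" unfolding B_def
    proof (rule PiE_I)
      show "z i \<in> {- int (4 * n)..int (4 * n)}" if "i \<in> {..<n}" for i
        using bd[of i] that unfolding lessThan_iff atLeastAtMost_iff by linarith
      show "z i = undefined" if "i \<notin> {..<n}" for i
        using z that unfolding lattice_ball_def by (auto intro: PiE_arb)
    qed
  qed
  define f :: "int \<Rightarrow> real" where "f k = 16 / 2 ^ nat \<bar>k\<bar>" for k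
  have f0: "f k \<ge> 0" for k by (simp add: f_def)
  have one: "1 \<le> (\<Prod>i<n. f (z i))" if z: "z \<in> lattice_ball n" for z
  proof -
    have "(\<Sum>i<n. \<bar>z i\<bar>) \<le> (\<Sum>i<n. (z i)\<^sup>2)" by (intro sum_mono abs_le)
    also have "\<dots> \<le> 4 * int n" using z by (simp add: lattice_ball_def)
    finally have "int (\<Sum>i<n. nat \<bar>z i\<bar>) \<le> int (4 * n)" by simp
    then have "(\<Sum>i<n. nat \<bar>z i\<bar>) \<le> 4 * n" by linarith
    then have "(2 :: real) ^ (\<Sum>i<n. nat \<bar>z i\<bar>) \<le> 2 ^ (4 * n)"
      by (intro power_increasing) auto
    also have "\<dots> = 16 ^ n" unfolding power_mult by simp
    finally have "1 \<le> (16 :: real) ^ n / 2 ^ (\<Sum>i<n. nat \<bar>z i\<bar>)" by (subst le_divide_eq_1_pos) simp_all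
    also have "\<dots> = (\<Prod>i<n. f (z i))"
      unfolding f_def prod_dividef power_sum by simp
    finally show ?thesis .
  qed
  have "real (card (lattice_ball n)) = (\<Sum>z\<in>lattice_ball n. 1)" by simp
  also have "\<dots> \<le> (\<Sum>z\<in>lattice_ball n. \<Prod>i<n. f (z i))"
    by (intro sum_mono one)
  also have "\<dots> \<le> (\<Sum>z\<in>B. \<Prod>i<n. f (z i))"
    using finB sub by (intro sum_mono2 prod_nonneg) (auto simp: f0)
  also have "\<dots> = (\<Prod>i<n. \<Sum>k = - int (4 * n)..int (4 * n). f k)"
    unfolding B_def by (subst prod_sum_PiE) auto
  also have "\<dots> \<le> (\<Prod>i<n. 48)"
  proof (intro prod_mono conjI)
    \<comment> \<open>The two-sided geometric series with ratio 1/2 sums to less than three times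
      its central term 16.\<close>
    show "(\<Sum>k = - int (4 * n)..int (4 * n). f k) \<le> 48"
      unfolding f_def sum_half_powers_abs by simp
  qed (auto intro: sum_nonneg f0)
  finally show ?thesis using finite_subset[OF sub finB] by simp
qed

text \<open>A linear functional does not decrease when every coordinate is rounded up or down
  according to the sign of its coefficient.\<close>
lemma rounding_to_lattice_ball:
  fixes a x :: "nat \<Rightarrow> real"
  assumes x: "(\<Sum>i<n. (x i)\<^sup>2) \<le> real n"
  obtains z where "z \<in> lattice_ball n" "(\<Sum>i<n. a i * x i) \<le> (\<Sum>i<n. a i * real_of_int (z i))"
proof -
  define z where "z = (\<lambda>i\<in>{..<n}. if a i \<ge> 0 then \<lceil>x i\<rceil> else \<lfloor>x i\<rfloor>)"
  have "(real_of_int (z i))\<^sup>2 \<le> 2 * (x i)\<^sup>2 + 2" if "i < n" for i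
  proof -
    define d where "d = real_of_int (z i) - x i"
    have "\<bar>d\<bar> \<le> 1"
      using that unfolding d_def z_def by (simp, linarith)
    then have "d\<^sup>2 \<le> 1" by (simp add: abs_square_le_1)
    \<comment> \<open>Parallelogram identity for \<open>x i + d\<close>, the rounded value.\<close>
    moreover have "(real_of_int (z i))\<^sup>2 = 2 * (x i)\<^sup>2 + 2 * d\<^sup>2 - (x i - d)\<^sup>2"
      by (simp add: d_def power2_eq_square algebra_simps)
    ultimately show ?thesis using zero_le_power2[of "x i - d"] by linarith
  qed
  then have "(\<Sum>i<n. (real_of_int (z i))\<^sup>2) \<le> (\<Sum>i<n. 2 * (x i)\<^sup>2 + 2)"
    by (intro sum_mono) auto
  also have "\<dots> \<le> 4 * real n"
    using x by (simp add: sum.distrib flip: sum_distrib_left)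
  finally have "real_of_int (\<Sum>i<n. (z i)\<^sup>2) \<le> real_of_int (4 * int n)" by simp
  then have "z \<in> lattice_ball n"
    unfolding lattice_ball_def of_int_le_iff by (auto simp: z_def)
  moreover have "a i * x i \<le> a i * real_of_int (z i)" if "i < n" for i
    using that unfolding z_def by (auto intro: mult_left_mono mult_left_mono_neg)
  then have "(\<Sum>i<n. a i * x i) \<le> (\<Sum>i<n. a i * real_of_int (z i))"
    by (intro sum_mono) auto
  ultimately show ?thesis by (rule that)
qed

text \<open>For fixed \<open>y\<close> the form is linear in \<open>x\<close>, so \<open>x\<close>
  is rounded first; then \<open>y\<close> is rounded against the integer point found. Neither
  rounding lowers the value, so no approximation error arises.\<close>

lemma bilinear_form_le_of_lattice:
  fixes E :: "nat \<Rightarrow> nat \<Rightarrow> real"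
  assumes t: "\<And>z w. z \<in> lattice_ball n \<Longrightarrow> w \<in> lattice_ball n \<Longrightarrow>
      (\<Sum>i<n. \<Sum>j<n. E i j * real_of_int (z i) * real_of_int (w j)) \<le> t"
    and x: "(\<Sum>i<n. (x i)\<^sup>2) \<le> real n" and y: "(\<Sum>i<n. (y i)\<^sup>2) \<le> real n"
  shows "(\<Sum>i<n. \<Sum>j<n. E i j * x i * y j) \<le> t"
proof -
  obtain z where z: "z \<in> lattice_ball n"
    "(\<Sum>i<n. (\<Sum>j<n. E i j * y j) * x i) \<le> (\<Sum>i<n. (\<Sum>j<n. E i j * y j) * real_of_int (z i))"
    by (rule rounding_to_lattice_ball[OF x])
  obtain w where w: "w \<in> lattice_ball n"
    "(\<Sum>j<n. (\<Sum>i<n. E i j * real_of_int (z i)) * y j) \<le>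
      (\<Sum>j<n. (\<Sum>i<n. E i j * real_of_int (z i)) * real_of_int (w j))"
    by (rule rounding_to_lattice_ball[OF y])
  have "(\<Sum>i<n. \<Sum>j<n. E i j * x i * y j) = (\<Sum>i<n. (\<Sum>j<n. E i j * y j) * x i)"
    unfolding sum_distrib_right by (simp add: mult_ac)
  also note z(2)
  also have "(\<Sum>i<n. (\<Sum>j<n. E i j * y j) * real_of_int (z i)) =
      (\<Sum>j<n. (\<Sum>i<n. E i j * real_of_int (z i)) * y j)"
    unfolding sum_distrib_right by (subst sum.swap) (simp add: mult_ac)
  also note w(2)
  also have "(\<Sum>j<n. (\<Sum>i<n. E i j * real_of_int (z i)) * real_of_int (w j)) =
      (\<Sum>i<n. \<Sum>j<n. E i j * real_of_int (z i) * real_of_int (w j))"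
    unfolding sum_distrib_right by (rule sum.swap)
  also have "\<dots> \<le> t" using z w by (intro t)
  finally show ?thesis .
qed

text \<open>The form is evaluated at \<open>D y\<close> and \<open>y\<close>, both scaled to norm
  \<open>sqrt n\<close>; its value there is \<open>n\<close> times the ratio of their norms.\<close>

lemma operator_norm_le_of_lattice:
  fixes D :: "real mat"
  assumes D: "D \<in> carrier_mat n n" and t0: "t \<ge> 0"
    and t: "\<And>z w. z \<in> lattice_ball n \<Longrightarrow> w \<in> lattice_ball n \<Longrightarrow>
      (\<Sum>i<n. \<Sum>j<n. D $$ (i, j) * real_of_int (z i) * real_of_int (w j)) \<le> t * real n"
    and y: "y \<in> carrier_vec n"
  shows "vnorm (D *\<^sub>v y) \<le> t * vnorm y"
proof (cases "vnorm (D *\<^sub>v y) = 0 \<or> n = 0")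
  case True
  then show ?thesis using t0 vnorm_nonneg[of y] D by (auto simp: vnorm_def[of "D *\<^sub>v y"] scalar_prod_def)
next
  case False
  let ?u = "D *\<^sub>v y"
  have u: "?u \<in> carrier_vec n" using D y by simp
  have un: "?u $ i = (\<Sum>j<n. D $$ (i, j) * y $ j)" if "i < n" for i
    using that D y by (simp add: scalar_prod_def atLeast0LessThan)
  have pos: "vnorm ?u > 0" "real n > 0" using False vnorm_nonneg[of ?u] by auto
  have sq: "(\<Sum>i<n. (v $ i)\<^sup>2) = (vnorm v)\<^sup>2" if "v \<in> carrier_vec n" for v
    unfolding vnorm_sq using that by (simp add: scalar_prod_def atLeast0LessThan power2_eq_square)
  have "vnorm y \<noteq> 0"
  proof
    assume "vnorm y = 0"
    then have "y = 0\<^sub>v n" using scalar_prod_self_eq_0_iff[OF y] by (simp add: vnorm_def)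
    then show False using pos D by (simp add: vnorm_def scalar_prod_def)
  qed
  then have ypos: "vnorm y > 0" using vnorm_nonneg[of y] by simp
  define a where "a = sqrt (real n) / vnorm ?u"
  define b where "b = sqrt (real n) / vnorm y"
  have "(\<Sum>i<n. (a * ?u $ i)\<^sup>2) = a\<^sup>2 * (vnorm ?u)\<^sup>2"
    by (simp only: power_mult_distrib sum_distrib_left[symmetric] sq[OF u])
  also have "\<dots> \<le> real n" using pos by (simp add: a_def power_divide)
  finally have 1: "(\<Sum>i<n. (a * ?u $ i)\<^sup>2) \<le> real n" .
  have "(\<Sum>i<n. (b * y $ i)\<^sup>2) = b\<^sup>2 * (vnorm y)\<^sup>2"
    by (simp only: power_mult_distrib sum_distrib_left[symmetric] sq[OF y])
  also have "\<dots> \<le> real n" using ypos by (simp add: b_def power_divide)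
  finally have 2: "(\<Sum>i<n. (b * y $ i)\<^sup>2) \<le> real n" .
  have "(\<Sum>i<n. \<Sum>j<n. D $$ (i, j) * (a * ?u $ i) * (b * y $ j)) =
      (\<Sum>i<n. a * b * (?u $ i * (\<Sum>j<n. D $$ (i, j) * y $ j)))"
    unfolding sum_distrib_left by (intro sum.cong refl) (simp only: mult_ac)
  also have "\<dots> = (\<Sum>i<n. a * b * (?u $ i)\<^sup>2)"
    by (intro sum.cong refl) (simp add: un power2_eq_square)
  also have "\<dots> = a * b * (\<Sum>i<n. (?u $ i)\<^sup>2)"
    by (simp only: sum_distrib_left)
  also have "\<dots> = real n * (vnorm ?u / vnorm y)"
  proof -
    have "c / d * (c / e) * d\<^sup>2 = (c * c) * (d / e)" if "d > 0" for c d e :: real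
      using that by (simp add: power2_eq_square)
    from this[OF pos(1), of "sqrt (real n)" "vnorm y"] show ?thesis
      unfolding sq[OF u] a_def b_def by simp
  qed
  finally have eq: "(\<Sum>i<n. \<Sum>j<n. D $$ (i, j) * (a * ?u $ i) * (b * y $ j)) =
      real n * (vnorm ?u / vnorm y)" .
  have "real n * (vnorm ?u / vnorm y) \<le> t * real n"
    unfolding eq[symmetric] by (rule bilinear_form_le_of_lattice[OF t 1 2])
  then have "vnorm ?u / vnorm y \<le> t" using pos(2) by (metis mult.commute mult_le_cancel_left_pos)
  then show ?thesis using ypos by (simp add: pos_divide_le_eq)
qed

section \<open>The noise form as a sum over independent edges\<close>

lemma finite_upper_pairs: "finite (upper_pairs n)"
  by (rule finite_subset[of _ "{..<n} \<times> {..<n}"]) (auto simp: upper_pairs_def)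

lemma sum_square_eq_upper_pairs:
  fixes f :: "nat \<Rightarrow> nat \<Rightarrow> real"
  assumes "\<And>i. i < n \<Longrightarrow> f i i = 0"
  shows "(\<Sum>i<n. \<Sum>j<n. f i j) = (\<Sum>(i, j)\<in>upper_pairs n. f i j + f j i)"
proof -
  have fin: "finite (prod.swap ` upper_pairs n)" using finite_upper_pairs by blast
  have "(\<Sum>i<n. \<Sum>j<n. f i j) = (\<Sum>(i, j)\<in>{..<n} \<times> {..<n}. f i j)"
    by (simp add: sum.cartesian_product)
  also have "\<dots> = (\<Sum>(i, j)\<in>upper_pairs n \<union> prod.swap ` upper_pairs n. f i j)"
    using assms by (intro sum.mono_neutral_right)
      (auto simp: upper_pairs_def image_iff, metis linorder_neqE_nat)
  also have "\<dots> = (\<Sum>(i, j)\<in>upper_pairs n. f i j) + (\<Sum>(i, j)\<in>prod.swap ` upper_pairs n. f i j)"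
    by (rule sum.union_disjoint) (auto simp: upper_pairs_def intro: finite_upper_pairs[unfolded upper_pairs_def])
  also have "(\<Sum>(i, j)\<in>prod.swap ` upper_pairs n. f i j) = (\<Sum>(i, j)\<in>upper_pairs n. f j i)"
    by (subst sum.reindex) (auto simp: prod.case_eq_if intro!: sum.cong)
  finally show ?thesis by (simp add: sum.distrib prod.case_eq_if)
qed

text \<open>By \<open>(s + t)^2 \<le> 2 s^2 + 2 t^2\<close>, this bounds the sum of squared
  coefficients with which the edge variables enter the form.\<close>

lemma sum_squares_symmetrized_le:
  fixes z w :: "nat \<Rightarrow> real"
  shows "(\<Sum>(i, j)\<in>upper_pairs n. (z i * w j + z j * w i)\<^sup>2) \<le> 2 * (\<Sum>i<n. (z i)\<^sup>2) * (\<Sum>i<n. (w i)\<^sup>2)"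
proof -
  define f where "f i j = (if i = j then 0 else 2 * (z i)\<^sup>2 * (w j)\<^sup>2)" for i j
  have "(\<Sum>(i, j)\<in>upper_pairs n. (z i * w j + z j * w i)\<^sup>2) \<le> (\<Sum>(i, j)\<in>upper_pairs n. f i j + f j i)"
  proof (rule sum_mono, clarify)
    fix i j assume "(i, j) \<in> upper_pairs n"
    then have "f i j + f j i - (z i * w j + z j * w i)\<^sup>2 = (z i * w j - z j * w i)\<^sup>2"
      by (auto simp: f_def upper_pairs_def power2_eq_square algebra_simps)
    then show "(z i * w j + z j * w i)\<^sup>2 \<le> f i j + f j i"
      using zero_le_power2[of "z i * w j - z j * w i"] by linarith
  qed
  also have "\<dots> = (\<Sum>i<n. \<Sum>j<n. f i j)"
    by (rule sum_square_eq_upper_pairs[symmetric]) (simp add: f_def)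
  also have "\<dots> \<le> (\<Sum>i<n. \<Sum>j<n. 2 * (z i)\<^sup>2 * (w j)\<^sup>2)"
    by (intro sum_mono) (simp add: f_def)
  also have "\<dots> = 2 * (\<Sum>i<n. (z i)\<^sup>2) * (\<Sum>i<n. (w i)\<^sup>2)"
    by (simp add: sum_product sum_distrib_left mult_ac)
  finally show ?thesis .
qed

lemma model_mat_carrier: "model_mat p n \<in> carrier_mat n n"
  by (simp add: model_mat_def)

lemma adj_mat_carrier: "adj_mat n \<omega> \<in> carrier_mat n n"
  by (simp add: adj_mat_def)

lemma model_mat_sym: "transpose_mat (model_mat p n) = model_mat p n"
  by (rule eq_matI) (auto simp: model_mat_def abs_minus_commute)

lemma adj_mat_sym: "transpose_mat (adj_mat n \<omega>) = adj_mat n \<omega>"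
  by (rule eq_matI) (auto simp: adj_mat_def)

text \<open>Lattice points have squared norm at most \<open>4 * n\<close>, so the squared
  coefficients sum to at most \<open>32 * n^2\<close>. Hoeffding at level
  \<open>14 * sqrt n * n\<close> then gives the exponent
  \<open>- 2 * 196 / 32 * n = - 12.25 * n\<close>.\<close>

lemma noise_bilinear_tail:
  assumes p: "0 \<le> p" "p \<le> 1" and n: "n > 0"
    and z: "z \<in> lattice_ball n" and w: "w \<in> lattice_ball n"
  shows "measure_pmf.prob (edge_pmf p n) {\<omega>. (\<Sum>i<n. \<Sum>j<n.
      (adj_mat n \<omega> - model_mat p n) $$ (i, j) * real_of_int (z i) * real_of_int (w j)) \<ge> 14 * sqrt n * n}
    \<le> exp (- 12 * real n)"
proof -
  let ?z = "\<lambda>i. real_of_int (z i)" and ?w = "\<lambda>i. real_of_int (w i)"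
  let ?a = "\<lambda>(i, j). ?z i * ?w j + ?z j * ?w i"
  have sq: "(\<Sum>i<n. (real_of_int (v i))\<^sup>2) \<le> 4 * real n" if "v \<in> lattice_ball n" for v
  proof -
    have "real_of_int (\<Sum>i<n. (v i)\<^sup>2) \<le> real_of_int (4 * int n)"
      using that unfolding of_int_le_iff by (simp add: lattice_ball_def)
    then show ?thesis by simp
  qed
  have "(\<Sum>k\<in>upper_pairs n. (?a k)\<^sup>2) \<le> 2 * (\<Sum>i<n. (?z i)\<^sup>2) * (\<Sum>i<n. (?w i)\<^sup>2)"
    using sum_squares_symmetrized_le[of ?z ?w n] by (simp add: case_prod_beta)
  also have "\<dots> \<le> 2 * (4 * real n) * (4 * real n)"
    using sq[OF z] sq[OF w] by (intro mult_mono) (auto intro: sum_nonneg)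
  finally have V: "(\<Sum>k\<in>upper_pairs n. (?a k)\<^sup>2) \<le> 32 * (real n)\<^sup>2"
    by (simp add: power2_eq_square)
  have eq: "(\<Sum>i<n. \<Sum>j<n. (adj_mat n \<omega> - model_mat p n) $$ (i, j) * ?z i * ?w j) =
      (\<Sum>k\<in>upper_pairs n. ?a k * (of_bool (\<omega> k) - model_mat p n $$ k))" for \<omega>
    by (subst sum_square_eq_upper_pairs)
      (auto simp: adj_mat_def model_mat_def upper_pairs_def algebra_simps abs_minus_commute
        intro!: sum.cong)
  have pm: "(\<lambda>(i, j). bernoulli_pmf (model_mat p n $$ (i, j))) = (\<lambda>k. bernoulli_pmf (model_mat p n $$ k))"
    by (simp add: fun_eq_iff)
  have "measure_pmf.prob (edge_pmf p n) {\<omega>. (\<Sum>i<n. \<Sum>j<n.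
      (adj_mat n \<omega> - model_mat p n) $$ (i, j) * ?z i * ?w j) \<ge> 14 * sqrt n * n}
    \<le> exp (- 2 * (14 * sqrt n * n)\<^sup>2 / (32 * (real n)\<^sup>2))"
    unfolding eq edge_pmf_def pm
    by (rule bernoulli_sum_tail[OF finite_upper_pairs _ V])
      (use p n in \<open>auto simp: upper_pairs_def model_mat_def\<close>)
  also have "\<dots> \<le> exp (- 12 * real n)"
    using n by (simp add: power_mult_distrib)
  finally show ?thesis .
qed

theorem noise_operator_norm:
  assumes p: "0 \<le> p" "p \<le> 1" and n: "n > 0"
  shows "measure_pmf.prob (edge_pmf p n) {\<omega>. \<forall>y \<in> carrier_vec n.
      vnorm (model_mat p n *\<^sub>v y - adj_mat n \<omega> *\<^sub>v y) \<le> 14 * sqrt n * vnorm y} \<ge> 1 - real n powr (-3)"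
    (is "measure_pmf.prob ?P ?G \<ge> _")
proof -
  let ?f = "\<lambda>z w \<omega>. (\<Sum>i<n. \<Sum>j<n.
      (adj_mat n \<omega> - model_mat p n) $$ (i, j) * real_of_int (z i) * real_of_int (w j))"
  define bad where "bad zw = {\<omega>. ?f (fst zw) (snd zw) \<omega> \<ge> 14 * sqrt n * n}" for zw
  let ?N = "lattice_ball n \<times> lattice_ball n"
  note L = lattice_ball_finite_card[of n]
  have sub: "- ?G \<subseteq> (\<Union>zw\<in>?N. bad zw)"
  proof (rule ccontr)
    assume "\<not> ?thesis"
    then obtain \<omega> where "\<omega> \<notin> ?G" and nb: "\<forall>zw\<in>?N. \<omega> \<notin> bad zw" by blast
    have \<omega>: "?f z w \<omega> \<le> 14 * sqrt n * n" if "z \<in> lattice_ball n" "w \<in> lattice_ball n" for z w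
      using nb[rule_format, of "(z, w)"] that by (simp add: bad_def)
    have "vnorm (model_mat p n *\<^sub>v y - adj_mat n \<omega> *\<^sub>v y) \<le> 14 * sqrt n * vnorm y"
      if y: "y \<in> carrier_vec n" for y
    proof -
      have "vnorm ((adj_mat n \<omega> - model_mat p n) *\<^sub>v y) \<le> 14 * sqrt n * vnorm y"
        using y \<omega> by (intro operator_norm_le_of_lattice[of _ n] minus_carrier_mat model_mat_carrier) auto
      then show ?thesis
        using y vnorm_minus_commute[of "adj_mat n \<omega> *\<^sub>v y" n "model_mat p n *\<^sub>v y"]
          model_mat_carrier[of p n] adj_mat_carrier[of n \<omega>]
        by (simp add: minus_mult_distrib_mat_vec[of _ n n])
    qed
    then show False using \<open>\<omega> \<notin> ?G\<close> by blast
  qed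
  \<comment> \<open>Union bound over at most \<open>48 ^ (2 * n)\<close> pairs, a count below
    \<open>exp (9 * n)\<close>; the tail \<open>exp (- 12 * n)\<close> leaves
    \<open>exp (- 3 * n)\<close>.\<close>
  have "measure_pmf.prob ?P (- ?G) \<le> measure_pmf.prob ?P (\<Union>zw\<in>?N. bad zw)"
    by (rule measure_pmf.finite_measure_mono[OF sub]) simp
  also have "\<dots> \<le> (\<Sum>zw\<in>?N. measure_pmf.prob ?P (bad zw))"
    using L by (intro measure_pmf.finite_measure_subadditive_finite) auto
  also have "\<dots> \<le> (\<Sum>zw\<in>?N. exp (- 12 * real n))"
    unfolding bad_def by (intro sum_mono noise_bilinear_tail p n) auto
  also have "\<dots> = (real (card (lattice_ball n)))\<^sup>2 * exp (- 12 * real n)"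
    by (simp add: card_cartesian_product power2_eq_square)
  also have "\<dots> \<le> (48 ^ n)\<^sup>2 * exp (- 12 * real n)"
    using L by (intro mult_right_mono power_mono) auto
  also have "(48 ^ n)\<^sup>2 = (2304 :: real) ^ n"
    by (simp flip: power_mult power_mult_distrib add: power2_eq_square)
  also have "(2304 :: real) \<le> exp 1 ^ 9"
  proof -
    have "(2304 :: real) \<le> (5 / 2) ^ 9" by (simp add: power_divide)
    also have "\<dots> \<le> exp (1 :: real) ^ 9"
      using exp_lower_Taylor_quadratic[of 1] by (intro power_mono) auto
    finally show ?thesis .
  qed
  then have "(2304 :: real) ^ n * exp (- 12 * real n) \<le> (exp 1 ^ 9) ^ n * exp (- 12 * real n)"
    by (intro mult_right_mono power_mono) auto
  also have "(exp (1::real) ^ 9) ^ n = exp (9 * real n)"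
    by (simp flip: exp_of_nat_mult power_mult)
  also have "exp (9 * real n) * exp (- 12 * real n) = inverse (exp (real n)) ^ 3"
    by (simp flip: exp_add exp_minus exp_of_nat_mult)
  also have "\<dots> \<le> inverse (real n) ^ 3"
  proof -
    have "real n \<le> exp (real n)" using exp_ge_add_one_self[of "real n"] by linarith
    then show ?thesis using n by (intro power_mono le_imp_inverse_le) auto
  qed
  also have "\<dots> = real n powr (-3)"
    using n by (simp add: powr_minus power_inverse)
  finally have "measure_pmf.prob ?P (- ?G) \<le> real n powr (-3)" .
  then show ?thesis
    using measure_pmf.prob_compl[of ?G ?P] by (simp add: Compl_eq_Diff_UNIV)
qed

section \<open>Eigenvalue gap of the model matrix\<close>

text \<open>Pairs each index with its mirror image, so that only the rows of the upper half have to
  be computed.\<close>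

lemma sum_double_reflect:
  fixes g :: "nat \<Rightarrow> real"
  shows "(\<Sum>i<2 * m. g i) = (\<Sum>i<m. g i + g (2 * m - Suc i))"
proof -
  have "(\<Sum>i<2 * m. g i) = (\<Sum>i<m. g i) + (\<Sum>i\<in>{m..<2 * m}. g i)"
    by (subst sum.union_disjoint[symmetric]) (auto intro: sum.cong)
  also have "(\<Sum>i\<in>{m..<2 * m}. g i) = (\<Sum>i<m. g (2 * m - Suc i))"
    by (rule sum.reindex_bij_witness[of _ "\<lambda>i. 2 * m - Suc i" "\<lambda>i. 2 * m - Suc i"]) auto
  finally show ?thesis by (simp add: sum.distrib)
qed

text \<open>For \<open>i < m\<close> the band reaches the left border, so only its right end
  \<open>j < i + m\<close> is a constraint.\<close>

lemma model_mat_upper_half: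
  assumes "i < m" "j < 2 * m"
  shows "model_mat p (2 * m) $$ (i, j) = (if j \<noteq> i \<and> j < i + m then p else 0)"
  using assms by (auto simp: model_mat_def)

lemma model_mat_reflect:
  assumes "i < 2 * m" "j < 2 * m"
  shows "model_mat p (2 * m) $$ (2 * m - Suc i, 2 * m - Suc j) = model_mat p (2 * m) $$ (i, j)"
proof -
  have "\<bar>int (2 * m - Suc i) - int (2 * m - Suc j)\<bar> = \<bar>int i - int j\<bar>"
    using assms by linarith
  moreover have "2 * m - Suc i < 2 * m" "2 * m - Suc j < 2 * m" using assms by linarith+
  ultimately show ?thesis using assms by (simp only: model_mat_def index_mat prod.case)
qed

lemma model_mat_mult_nth:
  assumes "i < n"
  shows "(model_mat p n *\<^sub>v vec n f) $ i = (\<Sum>j<n. model_mat p n $$ (i, j) * f j)"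
  using assms model_mat_carrier[of p n] by (simp add: scalar_prod_def atLeast0LessThan)

lemma model_mat_mult_upper_half:
  assumes i: "i < m"
  shows "(model_mat p (2 * m) *\<^sub>v vec (2 * m) f) $ i = p * ((\<Sum>j<i + m. f j) - f i)"
proof -
  have "(model_mat p (2 * m) *\<^sub>v vec (2 * m) f) $ i =
      (\<Sum>j<2 * m. (if j \<noteq> i \<and> j < i + m then p else 0) * f j)"
    using i by (subst model_mat_mult_nth) (auto simp: model_mat_upper_half intro!: sum.cong)
  also have "\<dots> = (\<Sum>j\<in>{..<i + m} - {i}. p * f j)"
    using i by (intro sum.mono_neutral_cong_right) auto
  also have "\<dots> = p * ((\<Sum>j<i + m. f j) - f i)"
    using i by (simp add: sum_diff1 flip: sum_distrib_left)
  finally show ?thesis .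
qed

text \<open>The matrix commutes with the reversal of coordinates, hence maps even vectors to even
  ones and odd vectors to odd ones.\<close>

lemma model_mat_mult_reflect:
  assumes i: "i < 2 * m"
  shows "(model_mat p (2 * m) *\<^sub>v vec (2 * m) f) $ (2 * m - Suc i) =
    (model_mat p (2 * m) *\<^sub>v vec (2 * m) (\<lambda>j. f (2 * m - Suc j))) $ i"
proof -
  have "(model_mat p (2 * m) *\<^sub>v vec (2 * m) f) $ (2 * m - Suc i) =
      (\<Sum>j<2 * m. model_mat p (2 * m) $$ (2 * m - Suc i, j) * f j)"
    using i by (subst model_mat_mult_nth) auto
  also have "\<dots> = (\<Sum>j<2 * m. model_mat p (2 * m) $$ (2 * m - Suc i, 2 * m - Suc j) * f (2 * m - Suc j))"
    by (rule sum.reindex_bij_witness[of _ "\<lambda>i. 2 * m - Suc i" "\<lambda>i. 2 * m - Suc i"]) auto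
  also have "\<dots> = (\<Sum>j<2 * m. model_mat p (2 * m) $$ (i, j) * f (2 * m - Suc j))"
    using i by (intro sum.cong refl) (simp only: model_mat_reflect lessThan_iff)
  finally show ?thesis using i by (subst model_mat_mult_nth) auto
qed

section \<open>Test vectors and their images\<close>

definition ones_vec :: "nat \<Rightarrow> real vec" where
  "ones_vec m = vec (2 * m) (\<lambda>_. 1)"

definition ramp_vec :: "nat \<Rightarrow> real vec" where
  "ramp_vec m = vec (2 * m) (\<lambda>j. 2 * real j + 1 - 2 * real m)"

lemma test_vec_carrier: "ones_vec m \<in> carrier_vec (2 * m)" "ramp_vec m \<in> carrier_vec (2 * m)"
  by (simp_all add: ones_vec_def ramp_vec_def)

lemma model_mult_ones:
  assumes "i < m"
  shows "(model_mat p (2 * m) *\<^sub>v ones_vec m) $ i = p * (real i + real m - 1)"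
    and "(model_mat p (2 * m) *\<^sub>v ones_vec m) $ (2 * m - Suc i) = p * (real i + real m - 1)"
  using assms model_mat_mult_upper_half[of i m p "\<lambda>_. 1"] model_mat_mult_reflect[of i m p "\<lambda>_. 1"]
  by (simp_all add: ones_vec_def)

lemma sum_odd_shifted: "(\<Sum>j<k. 2 * real j + 1 - c) = (real k)\<^sup>2 - c * real k"
  by (induction k) (auto simp: power2_eq_square algebra_simps)

lemma model_mult_ramp:
  assumes i: "i < m"
  shows "(model_mat p (2 * m) *\<^sub>v ramp_vec m) $ i =
      p * ((real i)\<^sup>2 - 2 * real i + (2 * real m - 1 - (real m)\<^sup>2))" (is "?a")
    and "(model_mat p (2 * m) *\<^sub>v ramp_vec m) $ (2 * m - Suc i) =
      - p * ((real i)\<^sup>2 - 2 * real i + (2 * real m - 1 - (real m)\<^sup>2))" (is "?b")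
proof -
  show a: ?a
    unfolding ramp_vec_def using i
    by (simp only: model_mat_mult_upper_half sum_odd_shifted)
      (simp add: power2_eq_square algebra_simps)
  have "vec (2 * m) (\<lambda>j. 2 * real (2 * m - Suc j) + 1 - 2 * real m) = - ramp_vec m"
    unfolding ramp_vec_def by (rule eq_vecI) (auto simp: of_nat_diff)
  then have "(model_mat p (2 * m) *\<^sub>v ramp_vec m) $ (2 * m - Suc i) =
      (model_mat p (2 * m) *\<^sub>v (- ramp_vec m)) $ i"
    using i model_mat_mult_reflect[of i m p "\<lambda>j. 2 * real j + 1 - 2 * real m"]
    by (simp add: ramp_vec_def)
  also have "\<dots> = - (model_mat p (2 * m) *\<^sub>v ramp_vec m) $ i"
    using i model_mat_carrier[of p "2 * m"] test_vec_carrier(2)[of m]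
    by (simp add: scalar_prod_def sum_negf)
  finally show ?b using a by simp
qed

lemma scalar_prod_double:
  fixes v w :: "real vec"
  assumes "w \<in> carrier_vec (2 * m)"
  shows "scalar_prod v w = (\<Sum>i<m. v $ i * w $ i + v $ (2 * m - Suc i) * w $ (2 * m - Suc i))"
  using assms sum_double_reflect[of "\<lambda>i. v $ i * w $ i" m]
  by (simp add: scalar_prod_def atLeast0LessThan)

lemma model_mult_carrier: "model_mat p n *\<^sub>v v \<in> carrier_vec n"
  using model_mat_carrier[of p n] by (intro carrier_vecI) simp

lemma test_vec_nth:
  assumes "i < m"
  shows "ones_vec m $ i = 1" "ones_vec m $ (2 * m - Suc i) = 1"
    "ramp_vec m $ i = 2 * real i + 1 - 2 * real m"
    "ramp_vec m $ (2 * m - Suc i) = - (2 * real i + 1 - 2 * real m)"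
  using assms by (auto simp: ones_vec_def ramp_vec_def of_nat_diff)

lemma ones_norm: "scalar_prod (ones_vec m) (ones_vec m) = 2 * real m"
proof -
  have "scalar_prod (ones_vec m) (ones_vec m) = (\<Sum>i<m. 2)"
    unfolding scalar_prod_double[OF test_vec_carrier(1)]
    by (intro sum.cong refl) (simp add: test_vec_nth)
  then show ?thesis by simp
qed

lemma ramp_norm: "scalar_prod (ramp_vec m) (ramp_vec m) = 2 * (real m * (4 * (real m)\<^sup>2 - 1) / 3)"
proof -
  \<comment> \<open>The shift \<open>c\<close> stays independent of \<open>k\<close> so that
    induction applies; afterwards \<open>k = m\<close> and \<open>c = 2 * m\<close>.\<close>
  have S: "(\<Sum>i<k. (2 * real i + 1 - c)\<^sup>2) =
      real k * (4 * (real k)\<^sup>2 - 1) / 3 - 2 * c * (real k)\<^sup>2 + c\<^sup>2 * real k" for k c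
    by (induction k) (simp_all add: power2_eq_square field_simps)
  have "scalar_prod (ramp_vec m) (ramp_vec m) = 2 * (\<Sum>i<m. (2 * real i + 1 - 2 * real m)\<^sup>2)"
    unfolding scalar_prod_double[OF test_vec_carrier(2)] sum_distrib_left
    by (intro sum.cong refl) (simp add: test_vec_nth, simp add: power2_eq_square algebra_simps)
  then show ?thesis unfolding S by (simp add: power2_eq_square)
qed

lemma ones_ramp_orthogonal: "scalar_prod (ones_vec m) (ramp_vec m) = 0"
  unfolding scalar_prod_double[OF test_vec_carrier(2)]
  by (intro sum.neutral ballI) (simp add: test_vec_nth)

text \<open>One image is even and the other odd under reversal, so mirror terms cancel.\<close>

lemma model_ones_ramp_orthogonal:
  "scalar_prod (model_mat p (2 * m) *\<^sub>v ones_vec m) (model_mat p (2 * m) *\<^sub>v ramp_vec m) = 0"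
  unfolding scalar_prod_double[OF model_mult_carrier]
  by (intro sum.neutral ballI) (simp add: model_mult_ones model_mult_ramp)

lemma model_ones_norm:
  "scalar_prod (model_mat p (2 * m) *\<^sub>v ones_vec m) (model_mat p (2 * m) *\<^sub>v ones_vec m) =
    p\<^sup>2 * (2 * real m * ((real m - 1) * (14 * real m - 13) / 6))"
proof -
  have S: "(\<Sum>i<k. (real i + c)\<^sup>2) =
      real k * (real k - 1) * (2 * real k - 1) / 6 + c * real k * (real k - 1) + c\<^sup>2 * real k" for k c
    by (induction k) (simp_all add: power2_eq_square field_simps)
  have "scalar_prod (model_mat p (2 * m) *\<^sub>v ones_vec m) (model_mat p (2 * m) *\<^sub>v ones_vec m) =
      2 * p\<^sup>2 * (\<Sum>i<m. (real i + (real m - 1))\<^sup>2)"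
    unfolding scalar_prod_double[OF model_mult_carrier] sum_distrib_left
    by (intro sum.cong refl) (simp add: model_mult_ones, simp add: power2_eq_square algebra_simps)
  then show ?thesis unfolding S by (simp add: power2_eq_square field_simps)
qed

lemma model_ramp_norm:
  "scalar_prod (model_mat p (2 * m) *\<^sub>v ramp_vec m) (model_mat p (2 * m) *\<^sub>v ramp_vec m) =
    2 * p\<^sup>2 * (8 / 15 * real m ^ 5 - 7 / 6 * real m ^ 4 + 2 / 3 * real m ^ 3 + 2 / 3 * (real m)\<^sup>2 - 7 / 10 * real m)"
proof -
  have S: "(\<Sum>i<k. ((real i)\<^sup>2 - 2 * real i + c)\<^sup>2) =
      real k * (real k - 1) * (2 * real k - 1) * (3 * (real k)\<^sup>2 - 3 * real k - 1) / 30
      - (real k * (real k - 1))\<^sup>2 + (4 + 2 * c) * (real k * (real k - 1) * (2 * real k - 1)) / 6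
      - 2 * c * real k * (real k - 1) + c\<^sup>2 * real k" for k c
    by (induction k) (simp_all add: power2_eq_square field_simps)
  have "scalar_prod (model_mat p (2 * m) *\<^sub>v ramp_vec m) (model_mat p (2 * m) *\<^sub>v ramp_vec m) =
      2 * p\<^sup>2 * (\<Sum>i<m. ((real i)\<^sup>2 - 2 * real i + (2 * real m - 1 - (real m)\<^sup>2))\<^sup>2)"
    unfolding scalar_prod_double[OF model_mult_carrier] sum_distrib_left
    by (intro sum.cong refl) (simp add: model_mult_ramp, simp add: power2_eq_square)
  then show ?thesis unfolding S by (simp add: power2_eq_square eval_nat_numeral field_simps)
qed

text \<open>Entries are \<open>0\<close> or \<open>p\<close>, so squaring multiplies them by
  \<open>p\<close>, and the row sums are the coordinates of the image of the constant
  vector.\<close>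

lemma model_frobenius:
  "(\<Sum>i<2 * m. \<Sum>j<2 * m. (model_mat p (2 * m) $$ (i, j))\<^sup>2) = p\<^sup>2 * (3 * real m * (real m - 1))"
proof -
  have S: "(\<Sum>i<k. real i + c) = real k * (real k - 1) / 2 + c * real k" for k c
    by (induction k) (simp_all add: field_simps)
  have "(\<Sum>j<2 * m. (model_mat p (2 * m) $$ (i, j))\<^sup>2) = p * (model_mat p (2 * m) *\<^sub>v ones_vec m) $ i"
    if "i < 2 * m" for i
    unfolding ones_vec_def using that
    by (subst model_mat_mult_nth)
      (auto simp: sum_distrib_left model_mat_def power2_eq_square intro!: sum.cong)
  then have "(\<Sum>i<2 * m. \<Sum>j<2 * m. (model_mat p (2 * m) $$ (i, j))\<^sup>2) =
      (\<Sum>i<2 * m. p * (model_mat p (2 * m) *\<^sub>v ones_vec m) $ i)" by simp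
  also have "\<dots> = (\<Sum>i<m. 2 * p\<^sup>2 * (real i + (real m - 1)))"
    unfolding sum_double_reflect
    by (intro sum.cong refl) (simp add: model_mult_ones, simp add: power2_eq_square algebra_simps)
  also have "\<dots> = p\<^sup>2 * (3 * real m * (real m - 1))"
    unfolding sum_distrib_left[symmetric] S by (simp add: field_simps)
  finally show ?thesis .
qed

text \<open>The leading coefficient on the right is 7/3; its excess over 23/10 absorbs the linear
  term for large \<open>x\<close>.\<close>

lemma ones_norm_lower:
  fixes x :: real
  assumes "x \<ge> 1000"
  shows "23 / 10 * x\<^sup>2 \<le> (x - 1) * (14 * x - 13) / 6"
proof -
  have "27 * x \<le> 1 / 5 * x * x" using assms by (intro mult_right_mono) auto
  then show ?thesis by (simp add: power2_eq_square field_simps)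
qed

text \<open>The limiting Rayleigh quotient is 2/5. Choosing 39/100 leaves a surplus of 2/75 in the
  fifth power, which absorbs the negative fourth-power term.\<close>

lemma ramp_norm_lower:
  fixes x :: real
  assumes x: "x \<ge> 1000"
  shows "39 / 100 * x\<^sup>2 * (2 * (x * (4 * x\<^sup>2 - 1) / 3)) \<le>
    2 * (8 / 15 * x ^ 5 - 7 / 6 * x ^ 4 + 2 / 3 * x ^ 3 + 2 / 3 * x\<^sup>2 - 7 / 10 * x)"
proof -
  have 1: "1000 * x ^ 4 \<le> x ^ 5"
    using mult_right_mono[OF x, of "x ^ 4"] x by (simp add: power_numeral_reduce)
  have 2: "1000 * x \<le> x\<^sup>2"
    using mult_right_mono[OF x, of x] x by (simp add: power2_eq_square)
  have 3: "x ^ 3 \<ge> 0" "x ^ 4 \<ge> 0" using x by auto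
  have "39 / 100 * x\<^sup>2 * (2 * (x * (4 * x\<^sup>2 - 1) / 3)) = 26 / 25 * x ^ 5 - 13 / 50 * x ^ 3"
    by (simp add: power_numeral_reduce right_diff_distrib)
  moreover have "2 * (8 / 15 * x ^ 5 - 7 / 6 * x ^ 4 + 2 / 3 * x ^ 3 + 2 / 3 * x\<^sup>2 - 7 / 10 * x) =
        16 / 15 * x ^ 5 - 7 / 3 * x ^ 4 + 4 / 3 * x ^ 3 + 4 / 3 * x\<^sup>2 - 7 / 5 * x"
    by (simp add: right_diff_distrib distrib_left)
  moreover have "7 / 3 * c \<le> 2 / 75 * a" if "1000 * c \<le> a" "c \<ge> 0" for a c :: real
    using that by linarith
  note this[OF 1 3(2)]
  moreover have "7 / 5 * x \<le> 4 / 3 * x\<^sup>2" using 2 x by linarith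
  ultimately show ?thesis using 3 by linarith
qed

theorem model_mat_abs_gap:
  assumes p: "p > 0" and m: "m \<ge> 1000"
  shows "abs_gap (model_mat p (2 * m)) (2 * (3 / 100 * p * real m))"
  unfolding abs_gap_def
proof (intro allI impI, elim conjE)
  fix es assume es: "char_poly (model_mat p (2 * m)) = (\<Prod>a\<leftarrow>es. [:- a, 1:])"
    "sorted_wrt (\<lambda>a b. \<bar>a\<bar> \<ge> \<bar>b\<bar>) es"
  define x where "x = real m"
  have x: "x \<ge> 1000" using m by (simp add: x_def)
  define q where "q = p * x"
  have q: "q > 0" using p x by (simp add: q_def)
  obtain Q where "sorted_eigenbasis (2 * m) Q (model_mat p (2 * m)) es"
    using sorted_eigenbasis_exists[OF model_mat_carrier model_mat_sym _ es] m by auto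
  then interpret sorted_eigenbasis "2 * m" Q "model_mat p (2 * m)" es .
  let ?M = "model_mat p (2 * m)"
  let ?u = "ones_vec m" and ?w = "ramp_vec m"
  have "?u $ 0 \<noteq> 0" "?w $ 0 \<noteq> 0"
    using test_vec_nth(1,3)[of 0 m] m by auto
  then have nz: "?u \<noteq> 0\<^sub>v (2 * m)" "?w \<noteq> 0\<^sub>v (2 * m)"
    using m by (metis index_zero_vec(1) mult_pos_pos not_numeral_le_zero pos2 bot_nat_0.not_eq_extremum)+
  have u: "23 / 10 * q\<^sup>2 * scalar_prod ?u ?u \<le> scalar_prod (?M *\<^sub>v ?u) (?M *\<^sub>v ?u)"
  proof -
    have "(p\<^sup>2 * (2 * x)) * (23 / 10 * x\<^sup>2) \<le> (p\<^sup>2 * (2 * x)) * ((x - 1) * (14 * x - 13) / 6)"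
      using x by (intro mult_left_mono ones_norm_lower) auto
    moreover have "(p\<^sup>2 * (2 * x)) * (23 / 10 * x\<^sup>2) = 23 / 10 * q\<^sup>2 * (2 * x)"
      unfolding q_def power_mult_distrib by (simp only: mult_ac)
    ultimately show ?thesis
      unfolding model_ones_norm ones_norm x_def[symmetric] by (simp only: mult.assoc)
  qed
  have w: "39 / 100 * q\<^sup>2 * scalar_prod ?w ?w \<le> scalar_prod (?M *\<^sub>v ?w) (?M *\<^sub>v ?w)"
  proof -
    have le: "p\<^sup>2 * (39 / 100 * x\<^sup>2 * (2 * (x * (4 * x\<^sup>2 - 1) / 3))) \<le> p\<^sup>2 *
        (2 * (8 / 15 * x ^ 5 - 7 / 6 * x ^ 4 + 2 / 3 * x ^ 3 + 2 / 3 * x\<^sup>2 - 7 / 10 * x))"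
      by (rule mult_left_mono[OF ramp_norm_lower[OF x]]) simp
    have eq1: "p\<^sup>2 * (39 / 100 * x\<^sup>2 * c) = 39 / 100 * q\<^sup>2 * c" for c
      unfolding q_def power_mult_distrib by (simp only: mult_ac)
    have eq2: "p\<^sup>2 * (2 * c) = 2 * p\<^sup>2 * c" for c by (simp only: mult_ac)
    show ?thesis
      unfolding model_ramp_norm ramp_norm x_def[symmetric] using le unfolding eq1 eq2 .
  qed
  have e0: "23 / 10 * q\<^sup>2 \<le> (es ! 0)\<^sup>2"
  proof -
    have "23 / 10 * q\<^sup>2 * (2 * x) \<le> (es ! 0)\<^sup>2 * (2 * x)"
      using order_trans[OF u norm_mult_first[OF test_vec_carrier(1)]] unfolding ones_norm x_def .
    then show ?thesis by (rule mult_right_le_imp_le) (use x in simp)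
  qed
  have e1: "39 / 100 * q\<^sup>2 \<le> (es ! 1)\<^sup>2"
  proof (rule second_ge_of_plane[OF test_vec_carrier(1) nz(1) test_vec_carrier(2) nz(2)
        ones_ramp_orthogonal model_ones_ramp_orthogonal _ w])
    have "39 / 100 * q\<^sup>2 * scalar_prod ?u ?u \<le> 23 / 10 * q\<^sup>2 * scalar_prod ?u ?u"
      by (intro mult_right_mono scalar_prod_self_nonneg) auto
    then show "39 / 100 * q\<^sup>2 * scalar_prod ?u ?u \<le> scalar_prod (?M *\<^sub>v ?u) (?M *\<^sub>v ?u)"
      using u by (rule order_trans)
  qed
  have "p\<^sup>2 * (3 * x * (x - 1)) \<le> 3 * q\<^sup>2"
  proof -
    have "p\<^sup>2 * (3 * x * (x - 1)) \<le> p\<^sup>2 * (3 * x * x)"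
      using x by (intro mult_left_mono) auto
    also have "\<dots> = 3 * q\<^sup>2" by (simp add: q_def power2_eq_square)
    finally show ?thesis .
  qed
  then have tot: "(\<Sum>k<2 * m. (es ! k)\<^sup>2) \<le> 3 * q\<^sup>2"
    unfolding frobenius model_frobenius x_def .
  have part: "(\<Sum>k\<in>K. (es ! k)\<^sup>2) \<le> 3 * q\<^sup>2" if "K \<subseteq> {..<2 * m}" for K
  proof -
    have "(\<Sum>k\<in>K. (es ! k)\<^sup>2) \<le> (\<Sum>k<2 * m. (es ! k)\<^sup>2)"
      using that by (intro sum_mono2) auto
    then show ?thesis using tot by (rule order_trans)
  qed
  have sq_le: "\<bar>a\<bar> \<le> c * q" if "a\<^sup>2 \<le> d * q\<^sup>2" "d \<le> c\<^sup>2" "c \<ge> 0" for a c d :: real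
  proof -
    have "d * q\<^sup>2 \<le> c\<^sup>2 * q\<^sup>2" using that(2) by (intro mult_right_mono) auto
    then have "\<bar>a\<bar>\<^sup>2 \<le> (c * q)\<^sup>2"
      unfolding power2_abs power_mult_distrib using that(1) by (rule order_trans[rotated])
    then show ?thesis by (rule power2_le_imp_le) (use that(3) q in simp)
  qed
  have sq_ge: "c * q \<le> \<bar>a\<bar>" if "d * q\<^sup>2 \<le> a\<^sup>2" "c\<^sup>2 \<le> d" for a c d :: real
  proof -
    have "c\<^sup>2 * q\<^sup>2 \<le> d * q\<^sup>2" using that(2) by (intro mult_right_mono) auto
    then have "(c * q)\<^sup>2 \<le> \<bar>a\<bar>\<^sup>2"
      unfolding power2_abs power_mult_distrib using that(1) by (rule order_trans)
    then show ?thesis by (rule power2_le_imp_le) simp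
  qed
  \<comment> \<open>The decimals below are roots rounded to the safe side: 0.84 for 0.7, 1.51 for
    2.3, 0.56 for 0.31 and 0.62 for 0.39. The gap 0.06 is the difference of the last two.\<close>
  have "(es ! 0)\<^sup>2 + (es ! 1)\<^sup>2 \<le> 3 * q\<^sup>2" using part[of "{0, 1}"] m by simp
  then have "(es ! 1)\<^sup>2 \<le> 7 / 10 * q\<^sup>2" using e0 by linarith
  then have "\<bar>es ! 1\<bar> \<le> 84 / 100 * q" by (rule sq_le) (simp_all add: power2_eq_square)
  moreover have "151 / 100 * q \<le> \<bar>es ! 0\<bar>" using e0 by (rule sq_ge) (simp add: power2_eq_square)
  ultimately have gap0: "\<bar>es ! 1\<bar> + 6 / 100 * q \<le> \<bar>es ! 0\<bar>" using q by linarith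
  have gapk: "\<bar>es ! k\<bar> + 6 / 100 * q \<le> \<bar>es ! 1\<bar>" if k: "2 \<le> k" "k < length es" for k
  proof -
    have "(es ! 0)\<^sup>2 + ((es ! 1)\<^sup>2 + (es ! k)\<^sup>2) \<le> 3 * q\<^sup>2"
      using part[of "{0, 1, k}"] m k len by simp
    then have "(es ! k)\<^sup>2 \<le> 31 / 100 * q\<^sup>2" using e0 e1 by linarith
    then have "\<bar>es ! k\<bar> \<le> 56 / 100 * q" by (rule sq_le) (simp_all add: power2_eq_square)
    moreover have "62 / 100 * q \<le> \<bar>es ! 1\<bar>" using e1 by (rule sq_ge) (simp add: power2_eq_square)
    ultimately show ?thesis by linarith
  qed
  have "2 * (3 / 100 * p * real m) = 6 / 100 * q" by (simp add: q_def x_def)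
  then show "\<bar>es ! 1\<bar> + 2 * (3 / 100 * p * real m) \<le> \<bar>es ! 0\<bar> \<and>
      (\<forall>k. 2 \<le> k \<and> k < length es \<longrightarrow> \<bar>es ! k\<bar> + 2 * (3 / 100 * p * real m) \<le> \<bar>es ! 1\<bar>)"
    using gap0 gapk by simp
qed

section \<open>The main theorem\<close>

theorem theorem1:
  fixes p :: real
  assumes "0 < p" and "p < 1"
  shows "\<exists>C0 > 0. \<forall>n::nat. even n \<and> n > 0 \<longrightarrow>
    measure_pmf.prob (edge_pmf p n)
      {\<omega>. \<forall>lam lamh x xh.
            is_lambda2 (model_mat p n) lam \<and> eigenvector (model_mat p n) x lam \<and> vnorm x = 1 \<and>
            is_lambda2 (adj_mat n \<omega>) lamh \<and> eigenvector (adj_mat n \<omega>) xh lamh \<and> vnorm xh = 1 \<and>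
            scalar_prod x xh \<ge> 0
            \<longrightarrow> vnorm (x - xh) \<le> C0 * real n powr (-1/2)}
    \<ge> 1 - real n powr (-3)"
proof (intro exI[of _ "2000 / p"] conjI allI impI)
  \<comment> \<open>For large \<open>n\<close> the perturbation bound has the constant
    \<open>5600 / 3 / p\<close>; for small \<open>n\<close> the value \<open>2000 / p\<close> makes
    the claim weaker than the trivial bound 2.\<close>
  show "2000 / p > 0" using assms by simp
  fix n :: nat assume n: "even n \<and> n > 0"
  have pw: "real n powr (-1/2) = 1 / sqrt (real n)"
    using n by (simp add: powr_minus_divide powr_half_sqrt)
  have s0: "sqrt (real n) > 0" using n by simp
  let ?T = "{\<omega>. \<forall>lam lamh x xh.
            is_lambda2 (model_mat p n) lam \<and> eigenvector (model_mat p n) x lam \<and> vnorm x = 1 \<and>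
            is_lambda2 (adj_mat n \<omega>) lamh \<and> eigenvector (adj_mat n \<omega>) xh lamh \<and> vnorm xh = 1 \<and>
            scalar_prod x xh \<ge> 0
            \<longrightarrow> vnorm (x - xh) \<le> 2000 / p * real n powr (-1/2)}"
  let ?G = "{\<omega>. \<forall>y \<in> carrier_vec n.
      vnorm (model_mat p n *\<^sub>v y - adj_mat n \<omega> *\<^sub>v y) \<le> 14 * sqrt n * vnorm y}"
  have "?G \<subseteq> ?T"
  proof (intro subsetI CollectI allI impI, elim conjE)
    fix \<omega> lam lamh x xh
    assume \<omega>: "\<omega> \<in> ?G"
      and x: "is_lambda2 (model_mat p n) lam" "eigenvector (model_mat p n) x lam" "vnorm x = 1"
      and xh: "is_lambda2 (adj_mat n \<omega>) lamh" "eigenvector (adj_mat n \<omega>) xh lamh" "vnorm xh = 1"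
      and pos: "scalar_prod x xh \<ge> 0"
    show "vnorm (x - xh) \<le> 2000 / p * real n powr (-1/2)"
    \<comment> \<open>The threshold ensures both \<open>14 * sqrt n \<le> g\<close> and, as
      \<open>p < 1\<close>, the size \<open>m \<ge> 1000\<close> required by the eigenvalue
      gap.\<close>
    proof (cases "sqrt (real n) \<ge> 1000 / p")
      case True
      obtain m where m: "n = 2 * m" using n by (elim conjE evenE)
      have ps: "1000 \<le> p * sqrt (real n)"
        using True assms by (simp add: pos_divide_le_eq mult.commute)
      also have "\<dots> \<le> 1 * sqrt (real n)" using assms by (intro mult_right_mono) auto
      finally have s: "sqrt (real n) \<ge> 1000" by simp
      then have "1000 * 1000 \<le> sqrt (real n) * sqrt (real n)" by (intro mult_mono) auto
      then have m1: "m \<ge> 1000" using m by simp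
      define g where "g = 3 / 100 * p * real m"
      have g: "g > 0" using assms m1 by (simp add: g_def)
      have geq: "g = 3 / 200 * (p * sqrt (real n)) * sqrt (real n)"
        unfolding g_def mult.assoc by (simp add: m)
      have "15 * sqrt (real n) \<le> g"
        unfolding geq using ps by (intro mult_right_mono) auto
      then have eta: "14 * sqrt (real n) \<le> g" using s0 by linarith
      have gap: "abs_gap (model_mat p n) (2 * g)"
        unfolding m g_def by (rule model_mat_abs_gap[OF assms(1) m1])
      have "vnorm (x - xh) \<le> 2 * (14 * sqrt (real n)) / g"
        by (rule lambda2_eigenvector_perturbation[OF model_mat_carrier model_mat_sym
              adj_mat_carrier adj_mat_sym _ gap g eta _ x xh pos]) (use \<omega> m m1 in auto)
      also have "\<dots> = 5600 / 3 / p * (1 / sqrt (real n))"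
        unfolding geq using s0 assms by simp
      also have "\<dots> \<le> 2000 / p * (1 / sqrt (real n))"
        using s0 assms by (intro mult_right_mono divide_right_mono) auto
      finally show ?thesis unfolding pw .
    next
      case False
      have c: "x \<in> carrier_vec n" "xh \<in> carrier_vec n"
        using x(2) xh(2) model_mat_carrier[of p n] adj_mat_carrier[of n \<omega>] by (auto simp: eigenvector_def)
      then have "(vnorm (x - xh))\<^sup>2 = (vnorm x)\<^sup>2 + (vnorm xh)\<^sup>2 - 2 * scalar_prod x xh"
        using comm_scalar_prod[of x n xh] unfolding vnorm_sq
        by (simp add: minus_scalar_prod_distrib[of _ n] scalar_prod_minus_distrib[of _ n])
      then have "(vnorm (x - xh))\<^sup>2 \<le> 2\<^sup>2" using x xh pos by simp
      then have "vnorm (x - xh) \<le> 2" by (rule power2_le_imp_le) simp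
      also have "2 \<le> 2000 / p * (1 / sqrt (real n))"
      proof -
        have "sqrt (real n) * p \<le> 1000"
          using False assms by (simp add: not_le less_divide_eq)
        then show ?thesis using s0 assms by (simp add: pos_le_divide_eq mult_ac)
      qed
      finally show ?thesis unfolding pw .
    qed
  qed
  then have "measure_pmf.prob (edge_pmf p n) ?G \<le> measure_pmf.prob (edge_pmf p n) ?T"
    by (intro measure_pmf.finite_measure_mono) auto
  then show "measure_pmf.prob (edge_pmf p n) ?T \<ge> 1 - real n powr (-3)"
    using noise_operator_norm[of p n] assms n by linarith
qed

end
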